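(* Let $\theta\in\mathbb R\setminus\mathbb Q$. The following statements are equivalent: (i) $\theta$ is a Liouville number, i.e. $\theta\in\mathfrak W_\infty$. (ii) There exists $\mu\in\mathbb P_\varepsilon$ such that $$\bigcap_{\lambda\in[1,\infty)}{}^*\mathbb Z^\mu_{\mu^\lambda}(\theta)\neq0.$$ (In particular, for such $\mu$, ${}^*\mathbb Z^\nu_\nu(\theta)\ne0$ for all $\nu\in(\mu^\infty,\mu]$.) (iii) There is a best denominator class of $\theta$ whose growth and decay have Frobenius orbits satisfying $\overline{\widehat\mu}>\overline{\widehat\nu}$.
   Context: Fix a nonprincipal ultrafilter $\mathfrak u$ on $\mathbb N$, and let ${}^*\mathbb Z\subset{}^*\mathbb R$ be the ultrapowers of $\mathbb Z\subset\mathbb R$. Let ${}^*\mathbb R_{\rm fin}$ be the ring of bounded elements, ${}^*\mathbb R_\varepsilon$ its ideal of infinitesimals, and $({}^*\mathbb R_{\rm fin})^\times_+$ the multiplicative group of positive elements that are neither infinite nor infinitesimal. Let $\mathbb P:=({}^*\mathbb R_{>0}\cup\{0\})/({}^*\mathbb R_{\rm fin})^\times_+$; write $\langle x\rangle\in\mathbb P$ for the class of $|x|$, and $-\infty:=\langle0\rangle$. $\mathbb P$ has the induced product and total order ($\mu<\mu'$ iff $x<x'$ for all representatives; $-\infty$ is the minimum). $\mathbb P_\varepsilon\subset\mathbb P$ is the set of classes of positive infinitesimals. For $\mu=\langle x\rangle\in\mathbb P_\varepsilon$ ($x>0$) and $r\in({}^*\mathbb R_{\rm fin})^\times_+$ put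 $\mu^r:=\langle x^r\rangle$ (the Frobenius action of $({}^*\mathbb R_{\rm fin})^\times_+$, well defined). The Frobenius orbit of $\mu$ is $\overline\mu:=\{\mu^r: r\in({}^*\mathbb R_{\rm fin})^\times_+\}$; orbits are ordered by $\overline\mu>\overline\nu$ iff every element of $\overline\mu$ is greater than every element of $\overline\nu$ (equivalently $\mu^r>\nu$ for every $r\in({}^*\mathbb R_{\rm fin})^\times_+$). Also $(\mu^\infty,\mu]:=\bigcup_{\kappa>1}\{\nu\in\mathbb P_\varepsilon:\mu^\kappa<\nu\le\mu\}$ ($\kappa$ real). For $0\ne n\in{}^*\mathbb Z$ the growth is $\mu(n):=\langle n\rangle^{-1}$. For $\theta\in\mathbb R$, ${}^*\mathbb Z(\theta)$ is the group of $n\in{}^*\mathbb Z$ for which there is a (unique) $n^\perp\in{}^*\mathbb Z$ with $\varepsilon(n):=n\theta-n^\perp\in{}^*\mathbb R_\varepsilon$; the decay of $n\in{}^*\mathbb Z(\theta)$ is $\nu(n):=\langle\varepsilon(n)\rangle$. For $\mu,\nu\in\mathbb P_\varepsilon$, ${}^*\mathbb Z^\mu_\nu(\theta):=\{0\neq n\in{}^*\mathbb Z(\theta):\mu(n)>\mu,\ \nu(n)\le\nu\}\cup\{0\}$. $\mathfrak W_\infty$ is the set of irrational $\theta$ such that for every real $\kappa>1$ there are infinitely many $n\in\mathbb N$ with $\|n\theta\|<n^{-\kappa}$, $\|\cdot\|$ the distance to the nearest integer. Let $\theta\in\mathbb R\setminus\mathbb Q$ have continued fraction expansion $[a_0a_1a_2\dots]$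 with convergent denominators $q_0=1$, $q_1=a_1$, $q_{i+1}=a_{i+1}q_i+q_{i-1}$. A best denominator class is the class $\widehat q\in{}^*\mathbb Z(\theta)$ of a sequence $\{q_{n_i}\}_i$ with $n_i\le n_{i+1}$ for all $i$ and $n_i\to\infty$; its growth and decay are $\widehat\mu:=\mu(\widehat q)$, $\widehat\nu:=\nu(\widehat q)$. *)

theory Defs
  imports Complex_Main
begin

section \<open>Ultrapowers of the integers and the reals\<close>

definition nonprincipal_ultrafilter :: "nat filter \<Rightarrow> bool" where
  "nonprincipal_ultrafilter U \<longleftrightarrow>
     U \<noteq> bot \<and>
     (\<forall>P. eventually P U \<or> eventually (\<lambda>i. \<not> P i) U) \<and>
     (\<forall>k. U \<noteq> principal {k})"

definition ultra_rel :: "nat filter \<Rightarrow> ((nat \<Rightarrow> real) \<times> (nat \<Rightarrow> real)) set" where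
  "ultra_rel U = {(x, y). \<forall>\<^sub>F i in U. x i = y i}"

type_synonym hyperreal = "(nat \<Rightarrow> real) set"

definition star :: "nat filter \<Rightarrow> (nat \<Rightarrow> real) \<Rightarrow> hyperreal" where
  "star U x = ultra_rel U `` {x}"

definition hyperreals :: "nat filter \<Rightarrow> hyperreal set" where
  "hyperreals U = UNIV // ultra_rel U"

text \<open>The ultrapower of the integers, as a subset of the ultrapower of the reals.\<close>

definition hyperints :: "nat filter \<Rightarrow> hyperreal set" where
  "hyperints U = {star U (\<lambda>i. real_of_int (n i)) | n. True}"

definition hconst :: "nat filter \<Rightarrow> real \<Rightarrow> hyperreal" where
  "hconst U c = star U (\<lambda>_. c)"

definition hlift1 :: "nat filter \<Rightarrow> (real \<Rightarrow> real) \<Rightarrow> hyperreal \<Rightarrow> hyperreal" where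
  "hlift1 U f X = (\<Union>x\<in>X. star U (\<lambda>i. f (x i)))"

definition hlift2 ::
  "nat filter \<Rightarrow> (real \<Rightarrow> real \<Rightarrow> real) \<Rightarrow> hyperreal \<Rightarrow> hyperreal \<Rightarrow> hyperreal" where
  "hlift2 U f X Y = (\<Union>x\<in>X. \<Union>y\<in>Y. star U (\<lambda>i. f (x i) (y i)))"

definition hless :: "nat filter \<Rightarrow> hyperreal \<Rightarrow> hyperreal \<Rightarrow> bool" where
  "hless U X Y \<longleftrightarrow> (\<exists>x\<in>X. \<exists>y\<in>Y. \<forall>\<^sub>F i in U. x i < y i)"

abbreviation habs :: "nat filter \<Rightarrow> hyperreal \<Rightarrow> hyperreal" where
  "habs U \<equiv> hlift1 U abs"

abbreviation hinverse :: "nat filter \<Rightarrow> hyperreal \<Rightarrow> hyperreal" where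
  "hinverse U \<equiv> hlift1 U inverse"

abbreviation hdiff :: "nat filter \<Rightarrow> hyperreal \<Rightarrow> hyperreal \<Rightarrow> hyperreal" where
  "hdiff U \<equiv> hlift2 U (-)"

abbreviation hmult :: "nat filter \<Rightarrow> hyperreal \<Rightarrow> hyperreal \<Rightarrow> hyperreal" where
  "hmult U \<equiv> hlift2 U (*)"

abbreviation hpowr :: "nat filter \<Rightarrow> hyperreal \<Rightarrow> hyperreal \<Rightarrow> hyperreal" where
  "hpowr U \<equiv> hlift2 U (powr)"

definition hfin :: "nat filter \<Rightarrow> hyperreal set" where
  "hfin U = {X \<in> hyperreals U. \<exists>c. hless U (habs U X) (hconst U c)}"

definition infinitesimals :: "nat filter \<Rightarrow> hyperreal set" where
  "infinitesimals U = {X \<in> hyperreals U. \<forall>c>0. hless U (habs U X) (hconst U c)}"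

definition hpos :: "nat filter \<Rightarrow> hyperreal set" where
  "hpos U = {X \<in> hyperreals U. hless U (hconst U 0) X}"

definition pos_fin_units :: "nat filter \<Rightarrow> hyperreal set" where
  "pos_fin_units U = hpos U \<inter> (hfin U - infinitesimals U)"

section \<open>Growth-decay classes and the Frobenius action\<close>

type_synonym growth_class = "hyperreal set"

definition growth_rel :: "nat filter \<Rightarrow> (hyperreal \<times> hyperreal) set" where
  "growth_rel U = {(X, Y). X \<in> hpos U \<union> {hconst U 0} \<and> Y \<in> hpos U \<union> {hconst U 0} \<and>
                           (\<exists>R \<in> pos_fin_units U. Y = hmult U R X)}"

definition growth_space :: "nat filter \<Rightarrow> growth_class set" where
  "growth_space U = (hpos U \<union> {hconst U 0}) // growth_rel U"

definition gclass :: "nat filter \<Rightarrow> hyperreal \<Rightarrow> growth_class" where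
  "gclass U X = growth_rel U `` {habs U X}"

definition gless :: "nat filter \<Rightarrow> growth_class \<Rightarrow> growth_class \<Rightarrow> bool" where
  "gless U \<mu> \<nu> \<longleftrightarrow> (\<forall>X\<in>\<mu>. \<forall>Y\<in>\<nu>. hless U X Y)"

definition gle :: "nat filter \<Rightarrow> growth_class \<Rightarrow> growth_class \<Rightarrow> bool" where
  "gle U \<mu> \<nu> \<longleftrightarrow> gless U \<mu> \<nu> \<or> \<mu> = \<nu>"

text \<open>Inverse in the group of classes of positive elements, as the inverse of a coset.\<close>

definition ginverse :: "nat filter \<Rightarrow> growth_class \<Rightarrow> growth_class" where
  "ginverse U \<mu> = hinverse U ` \<mu>"

definition growth_eps :: "nat filter \<Rightarrow> growth_class set" where
  "growth_eps U = gclass U ` (infinitesimals U \<inter> hpos U)"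

definition frobenius :: "nat filter \<Rightarrow> growth_class \<Rightarrow> hyperreal \<Rightarrow> growth_class" where
  "frobenius U \<mu> R = (\<Union>X\<in>\<mu>. gclass U (hpowr U X R))"

definition frobenius_orbit :: "nat filter \<Rightarrow> growth_class \<Rightarrow> growth_class set" where
  "frobenius_orbit U \<mu> = frobenius U \<mu> ` pos_fin_units U"

definition orbit_less ::
  "nat filter \<Rightarrow> growth_class set \<Rightarrow> growth_class set \<Rightarrow> bool" where
  "orbit_less U A B \<longleftrightarrow> (\<forall>\<alpha>\<in>A. \<forall>\<beta>\<in>B. gless U \<alpha> \<beta>)"

text \<open>The half-open interval from \<open>\<mu>\<^sup>\<infinity>\<close> (excluded) to \<open>\<mu>\<close> (included).\<close>

definition frobenius_interval :: "nat filter \<Rightarrow> growth_class \<Rightarrow> growth_class set" where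
  "frobenius_interval U \<mu> =
     (\<Union>\<kappa>\<in>{1<..}. {\<nu> \<in> growth_eps U. gless U (frobenius U \<mu> (hconst U \<kappa>)) \<nu> \<and> gle U \<nu> \<mu>})"

section \<open>Diophantine approximation groups\<close>

definition dioph_group :: "nat filter \<Rightarrow> real \<Rightarrow> hyperreal set" where
  "dioph_group U \<theta> = {n \<in> hyperints U. \<exists>m \<in> hyperints U.
      hdiff U (hmult U n (hconst U \<theta>)) m \<in> infinitesimals U}"

definition dual :: "nat filter \<Rightarrow> real \<Rightarrow> hyperreal \<Rightarrow> hyperreal" where
  "dual U \<theta> n = (THE m. m \<in> hyperints U \<and>
      hdiff U (hmult U n (hconst U \<theta>)) m \<in> infinitesimals U)"

definition error_term :: "nat filter \<Rightarrow> real \<Rightarrow> hyperreal \<Rightarrow> hyperreal" where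
  "error_term U \<theta> n = hdiff U (hmult U n (hconst U \<theta>)) (dual U \<theta> n)"

definition growth :: "nat filter \<Rightarrow> hyperreal \<Rightarrow> growth_class" where
  "growth U n = ginverse U (gclass U n)"

definition decay :: "nat filter \<Rightarrow> real \<Rightarrow> hyperreal \<Rightarrow> growth_class" where
  "decay U \<theta> n = gclass U (error_term U \<theta> n)"

definition dioph_bigroup ::
  "nat filter \<Rightarrow> real \<Rightarrow> growth_class \<Rightarrow> growth_class \<Rightarrow> hyperreal set" where
  "dioph_bigroup U \<theta> \<mu> \<nu> =
     {n \<in> dioph_group U \<theta>. n \<noteq> hconst U 0 \<and> gless U \<mu> (growth U n) \<and> gle U (decay U \<theta> n) \<nu>}
     \<union> {hconst U 0}"

definition dist_int :: "real \<Rightarrow> real" where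
  "dist_int x = \<bar>x - of_int (round x)\<bar>"

definition liouville_numbers :: "real set" where
  "liouville_numbers = {\<theta>. \<theta> \<notin> \<rat> \<and>
     (\<forall>\<kappa>>1. infinite {n::nat. n > 0 \<and> dist_int (real n * \<theta>) < real n powr (- \<kappa>)})}"

section \<open>Continued fractions and best denominators\<close>

fun complete_quotient :: "real \<Rightarrow> nat \<Rightarrow> real" where
  "complete_quotient \<theta> 0 = \<theta>"
| "complete_quotient \<theta> (Suc n) = 1 / frac (complete_quotient \<theta> n)"

definition partial_quotient :: "real \<Rightarrow> nat \<Rightarrow> int" where
  "partial_quotient \<theta> n = \<lfloor>complete_quotient \<theta> n\<rfloor>"

fun conv_denom :: "real \<Rightarrow> nat \<Rightarrow> int" where
  "conv_denom \<theta> 0 = 1"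
| "conv_denom \<theta> (Suc 0) = partial_quotient \<theta> 1"
| "conv_denom \<theta> (Suc (Suc n)) =
     partial_quotient \<theta> (Suc (Suc n)) * conv_denom \<theta> (Suc n) + conv_denom \<theta> n"

definition best_denom_classes :: "nat filter \<Rightarrow> real \<Rightarrow> hyperreal set" where
  "best_denom_classes U \<theta> = {star U (\<lambda>i. real_of_int (conv_denom \<theta> (s i))) | s.
     (\<forall>i. s i \<le> s (Suc i)) \<and> filterlim s at_top sequentially}"

section \<open>Well-definedness\<close>

lemma equiv_ultra_rel: "equiv UNIV (ultra_rel U)"
proof (rule equivI)
  show "ultra_rel U \<subseteq> UNIV \<times> UNIV" by simp
  show "refl (ultra_rel U)" by (simp add: refl_on_def ultra_rel_def)
  show "sym (ultra_rel U)"
    by (auto simp: sym_def ultra_rel_def elim: eventually_mono)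
  show "trans (ultra_rel U)"
    by (auto simp: trans_def ultra_rel_def elim: eventually_elim2)
qed

lemma mem_star: "y \<in> star U x \<longleftrightarrow> (\<forall>\<^sub>F i in U. x i = y i)"
  by (simp add: star_def ultra_rel_def)

lemma star_eq_iff: "star U x = star U y \<longleftrightarrow> (\<forall>\<^sub>F i in U. x i = y i)"
  using eq_equiv_class_iff[OF equiv_ultra_rel, of x y U]
  by (simp add: star_def ultra_rel_def)

lemma hyperreals_eq_range: "hyperreals U = range (star U)"
  by (auto simp: hyperreals_def quotient_def star_def)

lemma hlift1_star: "hlift1 U f (star U x) = star U (\<lambda>i. f (x i))"
proof -
  have "star U (\<lambda>i. f (x' i)) = star U (\<lambda>i. f (x i))" if "x' \<in> star U x" for x'
    using that unfolding mem_star star_eq_iff by eventually_elim simp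
  moreover have "x \<in> star U x" by (simp add: mem_star)
  ultimately show ?thesis unfolding hlift1_def by blast
qed

lemma hlift2_star: "hlift2 U f (star U x) (star U y) = star U (\<lambda>i. f (x i) (y i))"
proof -
  have "star U (\<lambda>i. f (x' i) (y' i)) = star U (\<lambda>i. f (x i) (y i))"
    if "x' \<in> star U x" "y' \<in> star U y" for x' y'
    using that unfolding mem_star star_eq_iff by eventually_elim simp
  moreover have "x \<in> star U x" "y \<in> star U y" by (simp_all add: mem_star)
  ultimately show ?thesis unfolding hlift2_def by blast
qed

lemma hless_star: "hless U (star U x) (star U y) \<longleftrightarrow> (\<forall>\<^sub>F i in U. x i < y i)"
proof
  assume "hless U (star U x) (star U y)"
  then obtain x' y' where "\<forall>\<^sub>F i in U. x i = x' i" "\<forall>\<^sub>F i in U. y i = y' i"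
      "\<forall>\<^sub>F i in U. x' i < y' i"
    by (auto simp: hless_def mem_star)
  then show "\<forall>\<^sub>F i in U. x i < y i" by eventually_elim simp
next
  assume "\<forall>\<^sub>F i in U. x i < y i"
  then show "hless U (star U x) (star U y)"
    unfolding hless_def
    by (intro bexI[of _ x] bexI[of _ y]) (simp_all add: mem_star)
qed

lemma dual_unique:
  assumes "n \<in> hyperreals U" and "m \<in> hyperints U" and "m' \<in> hyperints U"
    and "hdiff U (hmult U n (hconst U \<theta>)) m \<in> infinitesimals U"
    and "hdiff U (hmult U n (hconst U \<theta>)) m' \<in> infinitesimals U"
  shows "m = m'"
proof -
  obtain x where x: "n = star U x" using assms(1) by (auto simp: hyperreals_eq_range)
  obtain k k' where k: "m = star U (\<lambda>i. real_of_int (k i))" "m' = star U (\<lambda>i. real_of_int (k' i))"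
    using assms(2,3) by (auto simp: hyperints_def)
  have "hless U (habs U (hdiff U (hmult U n (hconst U \<theta>)) m)) (hconst U (1/2))"
    using assms(4) unfolding infinitesimals_def by fastforce
  then have 1: "\<forall>\<^sub>F i in U. \<bar>x i * \<theta> - real_of_int (k i)\<bar> < 1/2"
    by (simp add: x k hconst_def hlift1_star hlift2_star hless_star)
  have "hless U (habs U (hdiff U (hmult U n (hconst U \<theta>)) m')) (hconst U (1/2))"
    using assms(5) unfolding infinitesimals_def by fastforce
  then have 2: "\<forall>\<^sub>F i in U. \<bar>x i * \<theta> - real_of_int (k' i)\<bar> < 1/2"
    by (simp add: x k hconst_def hlift1_star hlift2_star hless_star)
  from 1 2 have "\<forall>\<^sub>F i in U. real_of_int (k i) = real_of_int (k' i)"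
  proof eventually_elim
    case (elim i)
    then have "\<bar>real_of_int (k i) - real_of_int (k' i)\<bar> < 1" by linarith
    then have "real_of_int \<bar>k i - k' i\<bar> < 1" by simp
    then have "\<bar>k i - k' i\<bar> < 1" by linarith
    then show ?case by simp
  qed
  then show ?thesis by (simp add: k star_eq_iff)
qed

lemma hpos_star: "star U x \<in> hpos U \<longleftrightarrow> (\<forall>\<^sub>F i in U. 0 < x i)"
  by (simp add: hpos_def hyperreals_eq_range hconst_def hless_star)

lemma pos_fin_units_star:
  assumes "nonprincipal_ultrafilter U"
  shows "star U r \<in> pos_fin_units U \<longleftrightarrow> (\<exists>c>0. \<exists>d. \<forall>\<^sub>F i in U. c < r i \<and> r i < d)"
proof
  assume "star U r \<in> pos_fin_units U"
  then obtain c d where c: "c > 0" "\<not> (\<forall>\<^sub>F i in U. \<bar>r i\<bar> < c)"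
    and d: "\<forall>\<^sub>F i in U. \<bar>r i\<bar> < d" and pos: "\<forall>\<^sub>F i in U. 0 < r i"
    by (auto simp: pos_fin_units_def hfin_def infinitesimals_def hpos_star hyperreals_eq_range
        hconst_def hlift1_star hless_star)
  have "\<forall>\<^sub>F i in U. \<not> \<bar>r i\<bar> < c"
    using assms c(2) unfolding nonprincipal_ultrafilter_def by blast
  with d pos have "\<forall>\<^sub>F i in U. c / 2 < r i \<and> r i < d"
    by eventually_elim (use c(1) in auto)
  then show "\<exists>c>0. \<exists>d. \<forall>\<^sub>F i in U. c < r i \<and> r i < d"
    using c(1) half_gt_zero by blast
next
  assume "\<exists>c>0. \<exists>d. \<forall>\<^sub>F i in U. c < r i \<and> r i < d"
  then obtain c d where c: "c > 0" and cd: "\<forall>\<^sub>F i in U. c < r i \<and> r i < d" by blast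
  have "\<forall>\<^sub>F i in U. 0 < r i" "\<forall>\<^sub>F i in U. \<bar>r i\<bar> < d"
    using cd by (eventually_elim, use c in auto)+
  moreover have "\<not> (\<forall>\<^sub>F i in U. \<bar>r i\<bar> < c)"
  proof
    assume "\<forall>\<^sub>F i in U. \<bar>r i\<bar> < c"
    with cd have "\<forall>\<^sub>F i in U. False" by eventually_elim auto
    with assms show False by (simp add: nonprincipal_ultrafilter_def)
  qed
  ultimately show "star U r \<in> pos_fin_units U"
    using c by (auto simp: pos_fin_units_def hfin_def infinitesimals_def hpos_star
        hyperreals_eq_range hconst_def hlift1_star hless_star)
qed

lemma growth_rel_star:
  assumes U: "nonprincipal_ultrafilter U" and pos: "\<forall>\<^sub>F i in U. 0 < x i"
  shows "(star U x, star U y) \<in> growth_rel U \<longleftrightarrow>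
           (\<exists>c>0. \<exists>d. \<forall>\<^sub>F i in U. c * x i < y i \<and> y i < d * x i)"
proof
  assume "(star U x, star U y) \<in> growth_rel U"
  then obtain R where R: "R \<in> pos_fin_units U" "star U y = hmult U R (star U x)"
    by (auto simp: growth_rel_def)
  then obtain r where r: "R = star U r"
    by (auto simp: pos_fin_units_def hpos_def hyperreals_eq_range)
  obtain c d where c: "c > 0" and cd: "\<forall>\<^sub>F i in U. c < r i \<and> r i < d"
    using R(1) pos_fin_units_star[OF U] unfolding r by blast
  have "\<forall>\<^sub>F i in U. y i = r i * x i"
    using R(2) by (simp add: r hlift2_star star_eq_iff)
  with cd pos have "\<forall>\<^sub>F i in U. c * x i < y i \<and> y i < d * x i"
    by eventually_elim auto
  with c show "\<exists>c>0. \<exists>d. \<forall>\<^sub>F i in U. c * x i < y i \<and> y i < d * x i" by blast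
next
  assume "\<exists>c>0. \<exists>d. \<forall>\<^sub>F i in U. c * x i < y i \<and> y i < d * x i"
  then obtain c d where c: "c > 0" and cd: "\<forall>\<^sub>F i in U. c * x i < y i \<and> y i < d * x i"
    by blast
  from cd pos have "\<forall>\<^sub>F i in U. c < y i / x i \<and> y i / x i < d"
    by eventually_elim (auto simp: field_simps)
  then have 1: "star U (\<lambda>i. y i / x i) \<in> pos_fin_units U"
    using c pos_fin_units_star[OF U] by blast
  have 2: "star U y = hmult U (star U (\<lambda>i. y i / x i)) (star U x)"
    unfolding hlift2_star star_eq_iff using pos by eventually_elim auto
  have 3: "\<forall>\<^sub>F i in U. 0 < y i"
    using cd pos by eventually_elim (use c in \<open>meson less_trans mult_pos_pos\<close>)
  have 4: "star U x \<in> hpos U" "star U y \<in> hpos U"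
    using pos 3 by (simp_all add: hpos_star)
  from 1 2 4 show "(star U x, star U y) \<in> growth_rel U"
    unfolding growth_rel_def by blast
qed

lemma gclass_eqI:
  assumes U: "nonprincipal_ultrafilter U" and pos: "\<forall>\<^sub>F i in U. 0 < x i"
    and rel: "(star U x, star U y) \<in> growth_rel U"
  shows "gclass U (star U x) = gclass U (star U y)"
proof -
  obtain c d where c: "c > 0" and cd: "\<forall>\<^sub>F i in U. c * x i < y i \<and> y i < d * x i"
    using rel growth_rel_star[OF U pos] by blast
  have posy: "\<forall>\<^sub>F i in U. 0 < y i"
    using cd pos by eventually_elim (use c in \<open>meson less_trans mult_pos_pos\<close>)
  have d: "d > 0"
  proof (rule ccontr)
    assume "\<not> d > 0"
    from cd pos posy have "\<forall>\<^sub>F i in U. False"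
    proof eventually_elim
      case (elim i)
      have "d * x i \<le> 0" using \<open>\<not> d > 0\<close> elim by (intro mult_nonpos_nonneg) auto
      with elim show False by linarith
    qed
    with U show False by (simp add: nonprincipal_ultrafilter_def)
  qed
  have "(star U x, star U z) \<in> growth_rel U \<longleftrightarrow> (star U y, star U z) \<in> growth_rel U" for z
    unfolding growth_rel_star[OF U pos] growth_rel_star[OF U posy]
  proof
    assume "\<exists>a>0. \<exists>b. \<forall>\<^sub>F i in U. a * x i < z i \<and> z i < b * x i"
    then obtain a b where a: "a > 0" and ab: "\<forall>\<^sub>F i in U. a * x i < z i \<and> z i < b * x i" by blast
    have "\<forall>\<^sub>F i in U. a / d * y i < z i \<and> z i < (\<bar>b\<bar> / c) * y i"
      using ab cd pos
    proof eventually_elim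
      case (elim i)
      have "a * y i \<le> a * (d * x i)" using a elim by (intro mult_left_mono) auto
      then have "a / d * y i \<le> a * x i" using d by (simp add: field_simps)
      moreover have "\<bar>b\<bar> * (c * x i) \<le> \<bar>b\<bar> * y i" using elim by (intro mult_left_mono) auto
      then have "\<bar>b\<bar> * x i \<le> (\<bar>b\<bar> / c) * y i" using c by (simp add: field_simps)
      moreover have "b * x i \<le> \<bar>b\<bar> * x i" using elim by (intro mult_right_mono) auto
      ultimately show ?case using elim by linarith
    qed
    moreover have "a / d > 0" using a d by simp
    ultimately show "\<exists>a>0. \<exists>b. \<forall>\<^sub>F i in U. a * y i < z i \<and> z i < b * y i" by blast
  next
    assume "\<exists>a>0. \<exists>b. \<forall>\<^sub>F i in U. a * y i < z i \<and> z i < b * y i"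
    then obtain a b where a: "a > 0" and ab: "\<forall>\<^sub>F i in U. a * y i < z i \<and> z i < b * y i" by blast
    have "\<forall>\<^sub>F i in U. a * c * x i < z i \<and> z i < (\<bar>b\<bar> * d) * x i"
      using ab cd posy
    proof eventually_elim
      case (elim i)
      have "a * (c * x i) \<le> a * y i" using a elim by (intro mult_left_mono) auto
      moreover have "\<bar>b\<bar> * y i \<le> \<bar>b\<bar> * (d * x i)" using elim by (intro mult_left_mono) auto
      moreover have "b * y i \<le> \<bar>b\<bar> * y i" using elim by (intro mult_right_mono) auto
      ultimately show ?case using elim unfolding mult.assoc by linarith
    qed
    moreover have "a * c > 0" using a c by simp
    ultimately show "\<exists>a>0. \<exists>b. \<forall>\<^sub>F i in U. a * x i < z i \<and> z i < b * x i" by blast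
  qed
  then have "Z \<in> growth_rel U `` {star U x} \<longleftrightarrow> Z \<in> growth_rel U `` {star U y}"
    if "\<exists>z. Z = star U z" for Z
    using that by auto
  moreover have "habs U (star U x) = star U x" "habs U (star U y) = star U y"
    unfolding hlift1_star star_eq_iff using pos posy by (eventually_elim, simp)+
  moreover have "\<exists>z. Z = star U z" if "(X, Z) \<in> growth_rel U" for X Z
    using that by (auto simp: growth_rel_def hpos_def hyperreals_eq_range hconst_def)
  ultimately show ?thesis unfolding gclass_def by (metis Image_singleton_iff set_eqI)
qed

lemma frobenius_gclass:
  assumes U: "nonprincipal_ultrafilter U" and X: "X \<in> hpos U" and R: "R \<in> pos_fin_units U"
  shows "frobenius U (gclass U X) R = gclass U (hpowr U X R)"
proof -
  obtain x r where x: "X = star U x" and r: "R = star U r"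
    using X R by (auto simp: pos_fin_units_def hpos_def hyperreals_eq_range)
  have pos: "\<forall>\<^sub>F i in U. 0 < x i" using X by (simp add: x hpos_star)
  have absx: "habs U X = X"
    unfolding x hlift1_star star_eq_iff using pos by eventually_elim simp
  obtain a b where a: "a > 0" and ab: "\<forall>\<^sub>F i in U. a < r i \<and> r i < b"
    using R pos_fin_units_star[OF U] unfolding r by blast
  have eq: "gclass U (hpowr U Y R) = gclass U (hpowr U X R)" if "Y \<in> gclass U X" for Y
  proof -
    have rel: "(X, Y) \<in> growth_rel U" using that by (simp add: gclass_def absx)
    then obtain y where y: "Y = star U y"
      by (auto simp: growth_rel_def hpos_def hyperreals_eq_range hconst_def)
    obtain c d where c: "c > 0" and cd: "\<forall>\<^sub>F i in U. c * x i < y i \<and> y i < d * x i"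
      using rel growth_rel_star[OF U pos] unfolding x y by blast
    define c' where "c' = min c 1"
    define d' where "d' = max d 1"
    have c': "0 < c'" "c' \<le> 1" "c' \<le> c" and d': "d' \<ge> 1" "d' \<ge> d"
      using c by (auto simp: c'_def d'_def)
    have "\<forall>\<^sub>F i in U. c' powr b * x i powr r i < y i powr r i \<and>
            y i powr r i < d' powr b * x i powr r i"
      using cd pos ab
    proof eventually_elim
      case (elim i)
      have r0: "r i > 0" using elim a by linarith
      have cy: "c' * x i < y i"
        using mult_right_mono[OF c'(3), of "x i"] elim by linarith
      have yd: "y i < d' * x i"
        using mult_right_mono[OF d'(2), of "x i"] elim by linarith
      have cx0: "0 < c' * x i" using c' elim by simp
      have "c' powr b * x i powr r i \<le> c' powr r i * x i powr r i"
        using c' elim by (intro mult_right_mono powr_mono') auto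
      also have "\<dots> = (c' * x i) powr r i" using c' elim by (simp add: powr_mult)
      also have "\<dots> < y i powr r i" using cy cx0 r0 by (intro powr_less_mono2) auto
      finally have 1: "c' powr b * x i powr r i < y i powr r i" .
      have "y i powr r i < (d' * x i) powr r i"
        using yd cy cx0 r0 by (intro powr_less_mono2) auto
      also have "\<dots> = d' powr r i * x i powr r i" using d' elim by (simp add: powr_mult)
      also have "\<dots> \<le> d' powr b * x i powr r i"
        using d' elim by (intro mult_right_mono powr_mono) auto
      finally show ?case using 1 by blast
    qed
    moreover have "c' powr b > 0" using c' by simp
    moreover have posr: "\<forall>\<^sub>F i in U. 0 < x i powr r i" using pos by eventually_elim simp
    ultimately have "(star U (\<lambda>i. x i powr r i), star U (\<lambda>i. y i powr r i)) \<in> growth_rel U"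
      using growth_rel_star[OF U posr] by blast
    from gclass_eqI[OF U posr this] show ?thesis by (simp add: x y r hlift2_star)
  qed
  have "\<forall>\<^sub>F i in U. 1/2 * x i < x i \<and> x i < 2 * x i" using pos by eventually_elim auto
  then have "\<exists>c>0. \<exists>d. \<forall>\<^sub>F i in U. c * x i < x i \<and> x i < d * x i"
    by (intro exI[of _ "1/2"] conjI exI[of _ 2]) simp_all
  then have "X \<in> gclass U X"
    using growth_rel_star[OF U pos, of x] by (simp add: gclass_def absx) (simp add: x)
  with eq show ?thesis unfolding frobenius_def by blast
qed

end

theory Submission
  imports Defs
begin

text \<open>
  If \<open>q\<^sub>j \<le> n < q\<^sub>j\<^sub>+\<^sub>1\<close>, then \<open>q\<^sub>j\<close> approximates \<open>\<theta>\<close> at least as well as \<open>n\<close> and is no larger. Hence a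
  Liouville number has convergent denominators \<open>q\<close>, indexed increasingly by \<open>i\<close>, with error below
  \<open>q\<close> to the power \<open>-i\<close>. In the ultrapower the decay of their class is smaller than every finite power of its
  growth, which separates the two Frobenius orbits, and the class lies in all the groups of (ii) for
  \<open>\<mu> = \<langle>q\<rangle>\<^sup>-\<^sup>2\<close>. Conversely, either condition yields a nonzero \<open>n\<close> with infinitesimal error smaller
  than every finite power of \<open>1/n\<close>; its representatives take infinitely many values because the
  error of a fixed nonzero integer is a fixed positive number.
\<close>

section \<open>Continued fraction convergents\<close>

fun conv_num :: "real \<Rightarrow> nat \<Rightarrow> int" where
  "conv_num \<theta> 0 = partial_quotient \<theta> 0"
| "conv_num \<theta> (Suc 0) = partial_quotient \<theta> 1 * partial_quotient \<theta> 0 + 1"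
| "conv_num \<theta> (Suc (Suc n)) =
     partial_quotient \<theta> (Suc (Suc n)) * conv_num \<theta> (Suc n) + conv_num \<theta> n"

text \<open>The sign is kept because the errors of successive convergents alternate around 0, and
  this alternation drives the best-approximation argument.\<close>

definition conv_error :: "real \<Rightarrow> nat \<Rightarrow> real" where
  "conv_error \<theta> n = real_of_int (conv_denom \<theta> n) * \<theta> - real_of_int (conv_num \<theta> n)"

lemma frac_pos_of_irrational: "0 < frac x" if "x \<notin> \<rat>" for x :: real
  using that Ints_subset_Rats by (auto simp: frac_gt_0_iff)

lemma complete_quotient_irrational:
  assumes "\<theta> \<notin> \<rat>"
  shows "complete_quotient \<theta> n \<notin> \<rat>"
proof (induction n)
  case 0
  then show ?case using assms by simp
next
  case (Suc n)
  show ?case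
  proof
    assume "complete_quotient \<theta> (Suc n) \<in> \<rat>"
    then have "inverse (1 / frac (complete_quotient \<theta> n)) \<in> \<rat>"
      by (metis Rats_inverse complete_quotient.simps(2))
    then have "frac (complete_quotient \<theta> n) + of_int \<lfloor>complete_quotient \<theta> n\<rfloor> \<in> \<rat>"
      by (intro Rats_add) auto
    with Suc show False by (simp add: frac_def)
  qed
qed

lemma partial_quotient_ge_1:
  assumes "\<theta> \<notin> \<rat>"
  shows "1 \<le> partial_quotient \<theta> (Suc n)"
proof -
  have "0 < frac (complete_quotient \<theta> n)"
    by (rule frac_pos_of_irrational[OF complete_quotient_irrational[OF assms]])
  then have "1 \<le> 1 / frac (complete_quotient \<theta> n)"
    using frac_lt_1[of "complete_quotient \<theta> n"] by simp
  then show ?thesis by (simp add: partial_quotient_def le_floor_iff)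
qed

lemma conv_denom_pos:
  assumes "\<theta> \<notin> \<rat>"
  shows "1 \<le> conv_denom \<theta> n"
proof -
  have "1 \<le> conv_denom \<theta> n \<and> 1 \<le> conv_denom \<theta> (Suc n)"
  proof (induction n)
    case 0
    then show ?case using partial_quotient_ge_1[OF assms, of 0] by simp
  next
    case (Suc n)
    then have "1 * 1 \<le> partial_quotient \<theta> (Suc (Suc n)) * conv_denom \<theta> (Suc n)"
      using partial_quotient_ge_1[OF assms, of "Suc n"] by (intro mult_mono) auto
    then show ?case using Suc by simp
  qed
  then show ?thesis by simp
qed

text \<open>Strictness starts only at index 1: the first two denominators are both 1 when
  \<open>partial_quotient \<theta> 1\<close> is 1.\<close>

lemma conv_denom_less_Suc:
  assumes "\<theta> \<notin> \<rat>"
  shows "conv_denom \<theta> (Suc n) < conv_denom \<theta> (Suc (Suc n))"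
proof -
  have "1 * conv_denom \<theta> (Suc n) \<le> partial_quotient \<theta> (Suc (Suc n)) * conv_denom \<theta> (Suc n)"
    using conv_denom_pos[OF assms, of "Suc n"] partial_quotient_ge_1[OF assms, of "Suc n"]
    by (intro mult_right_mono) auto
  then show ?thesis using conv_denom_pos[OF assms, of n] by simp
qed

lemma conv_denom_mono:
  assumes "\<theta> \<notin> \<rat>"
  shows "mono (conv_denom \<theta>)"
proof (rule incseq_SucI)
  show "conv_denom \<theta> n \<le> conv_denom \<theta> (Suc n)" for n
    using conv_denom_less_Suc[OF assms] partial_quotient_ge_1[OF assms, of 0]
    by (cases n) (auto simp: less_imp_le)
qed

lemma conv_denom_ge_index:
  assumes "\<theta> \<notin> \<rat>"
  shows "int n \<le> conv_denom \<theta> n"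
proof (induction n)
  case (Suc n)
  show ?case
  proof (cases n)
    case 0
    then show ?thesis using partial_quotient_ge_1[OF assms, of 0] by simp
  next
    case (Suc m)
    then show ?thesis using Suc.IH conv_denom_less_Suc[OF assms, of m] by simp
  qed
qed simp

text \<open>The induction hypothesis, solved for the older error, makes it minus the next complete
  quotient times the newer error. Inserted in the recurrence, only the fractional part of that
  quotient survives. Nonvanishing and alternating signs of the errors both follow from this.\<close>

lemma conv_error_Suc:
  assumes "\<theta> \<notin> \<rat>"
  shows "conv_error \<theta> (Suc n) = - frac (complete_quotient \<theta> (Suc n)) * conv_error \<theta> n"
proof (induction n)
  case 0
  have "0 < frac \<theta>" by (rule frac_pos_of_irrational[OF assms])
  then have inv: "1 / frac \<theta> * frac \<theta> = 1" by simp
  have "conv_error \<theta> (Suc 0) = real_of_int \<lfloor>1 / frac \<theta>\<rfloor> * frac \<theta> - 1"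
    by (simp add: conv_error_def partial_quotient_def frac_def[of \<theta>] algebra_simps)
  also have "\<dots> = - frac (1 / frac \<theta>) * frac \<theta>"
    using inv unfolding frac_def[of "1 / frac \<theta>"] by (simp add: left_diff_distrib)
  finally show ?case by (simp add: conv_error_def partial_quotient_def frac_def[of \<theta>])
next
  case (Suc n)
  define x where "x = complete_quotient \<theta> (Suc n)"
  have x: "0 < frac x"
    unfolding x_def by (rule frac_pos_of_irrational[OF complete_quotient_irrational[OF assms]])
  have "conv_error \<theta> (Suc (Suc n)) =
      partial_quotient \<theta> (Suc (Suc n)) * conv_error \<theta> (Suc n) + conv_error \<theta> n"
    by (simp add: conv_error_def algebra_simps)
  also have "conv_error \<theta> n = - (1 / frac x) * conv_error \<theta> (Suc n)"
    using Suc x by (simp add: x_def)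
  also have "1 / frac x = complete_quotient \<theta> (Suc (Suc n))" by (simp add: x_def)
  finally show ?case by (simp add: partial_quotient_def frac_def algebra_simps)
qed

lemma conv_error_nonzero:
  assumes "\<theta> \<notin> \<rat>"
  shows "conv_error \<theta> n \<noteq> 0"
proof (induction n)
  case 0
  show ?case using frac_pos_of_irrational[OF assms]
    by (simp add: conv_error_def partial_quotient_def frac_def)
next
  case (Suc n)
  have "0 < frac (complete_quotient \<theta> (Suc n))"
    by (rule frac_pos_of_irrational[OF complete_quotient_irrational[OF assms]])
  then show ?case using Suc conv_error_Suc[OF assms] by simp
qed

lemma conv_error_alternates:
  assumes "\<theta> \<notin> \<rat>"
  shows "conv_error \<theta> n * conv_error \<theta> (Suc n) < 0"
proof -
  have "0 < conv_error \<theta> n * conv_error \<theta> n"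
    using conv_error_nonzero[OF assms, of n] not_real_square_gt_zero by blast
  then have "0 < frac (complete_quotient \<theta> (Suc n)) * (conv_error \<theta> n * conv_error \<theta> n)"
    using frac_pos_of_irrational[OF complete_quotient_irrational[OF assms, of "Suc n"]]
    by (rule mult_pos_pos[rotated])
  then show ?thesis
    unfolding conv_error_Suc[OF assms, of n] by (simp add: algebra_simps)
qed

lemma conv_det:
  "conv_num \<theta> (Suc n) * conv_denom \<theta> n - conv_num \<theta> n * conv_denom \<theta> (Suc n) = (- 1) ^ n"
  by (induction n) (simp_all add: algebra_simps)

text \<open>The hypotheses prevent a * x and b * y from having opposite signs, so nothing cancels in
  the sum.\<close>

lemma abs_add_of_nonpos_mult:
  fixes a b x y :: real
  assumes "a * b \<le> 0" and "x * y < 0"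
  shows "\<bar>a * x + b * y\<bar> = \<bar>a\<bar> * \<bar>x\<bar> + \<bar>b\<bar> * \<bar>y\<bar>"
proof -
  have "0 \<le> (a * b) * (x * y)" using assms by (intro mult_nonpos_nonpos) auto
  then have "0 \<le> (a * x) * (b * y)" by (simp add: mult_ac)
  then show ?thesis unfolding abs_mult[symmetric] by (auto simp: zero_le_mult_iff)
qed

text \<open>Eliminating \<theta> from two consecutive errors leaves the determinant of the
  convergents, of absolute value 1. The two terms do not cancel, so each is at most 1.\<close>

lemma conv_error_bound:
  assumes "\<theta> \<notin> \<rat>"
  shows "\<bar>conv_error \<theta> n\<bar> \<le> 1 / conv_denom \<theta> (Suc n)"
proof -
  let ?q = "\<lambda>n. real_of_int (conv_denom \<theta> n)"
  have "?q (Suc n) * conv_error \<theta> n + (- ?q n) * conv_error \<theta> (Suc n) =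
      real_of_int (conv_num \<theta> (Suc n) * conv_denom \<theta> n - conv_num \<theta> n * conv_denom \<theta> (Suc n))"
    by (simp add: conv_error_def algebra_simps)
  then have "1 = \<bar>?q (Suc n) * conv_error \<theta> n + (- ?q n) * conv_error \<theta> (Suc n)\<bar>"
    by (simp add: conv_det)
  also have "\<dots> = \<bar>?q (Suc n)\<bar> * \<bar>conv_error \<theta> n\<bar> + \<bar>- ?q n\<bar> * \<bar>conv_error \<theta> (Suc n)\<bar>"
    using conv_denom_pos[OF assms, of n] conv_denom_pos[OF assms, of "Suc n"]
    by (intro abs_add_of_nonpos_mult conv_error_alternates[OF assms]) auto
  finally have "?q (Suc n) * \<bar>conv_error \<theta> n\<bar> \<le> 1"
    using conv_denom_pos[OF assms, of "Suc n"]
    by (smt (verit) abs_ge_zero abs_of_nonneg mult_nonneg_nonneg of_int_0_le_iff)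
  then show ?thesis using conv_denom_pos[OF assms, of "Suc n"] by (simp add: field_simps)
qed

text \<open>Two consecutive convergents form a basis of the integer lattice. In the coordinates a, b
  of (n, m), the bounds on n force a to be nonzero and exclude that a and b have the same strict
  sign. Since the errors alternate, the two contributions to the error of n add up in absolute
  value, and the first alone is large enough.\<close>

lemma best_approximation:
  assumes "\<theta> \<notin> \<rat>" and "0 < n" and "n < conv_denom \<theta> (Suc j)"
  shows "\<bar>conv_error \<theta> j\<bar> \<le> \<bar>real_of_int n * \<theta> - real_of_int m\<bar>"
proof -
  define p q p' q' where
    "p = conv_num \<theta> j" and "q = conv_denom \<theta> j" and
    "p' = conv_num \<theta> (Suc j)" and "q' = conv_denom \<theta> (Suc j)"
  define s :: int where "s = (- 1) ^ j"
  have det: "p' * q - p * q' = s" and ss: "s * s = 1"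
    by (simp_all add: p_def q_def p'_def q'_def s_def conv_det flip: power_mult_distrib)
  have q: "1 \<le> q" "1 \<le> q'" using conv_denom_pos[OF assms(1)] by (simp_all add: q_def q'_def)
  \<comment> \<open>Cramer's rule: the determinant s is its own inverse, so the coordinates are
    integers.\<close>
  define a b where "a = s * (n * p' - m * q')" and "b = s * (m * q - n * p)"
  have n: "n = a * q + b * q'"
  proof -
    have "a * q + b * q' = s * (n * (p' * q - p * q'))"
      by (simp add: a_def b_def algebra_simps)
    then show ?thesis using det ss by (simp add: mult.left_commute)
  qed
  have m: "m = a * p + b * p'"
  proof -
    have "a * p + b * p' = s * (m * (p' * q - p * q'))"
      by (simp add: a_def b_def algebra_simps)
    then show ?thesis using det ss by (simp add: mult.left_commute)
  qed
  have a0: "a \<noteq> 0"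
  proof
    assume "a = 0"
    then have "n = b * q'" using n by simp
    then have "0 < b" using assms(2) q by (simp add: zero_less_mult_iff)
    then have "1 * q' \<le> b * q'" using q by (intro mult_right_mono) auto
    then show False using \<open>n = b * q'\<close> assms(3) by (simp add: q'_def)
  qed
  \<comment> \<open>Coordinates of equal strict sign would give n at least q' or n negative.\<close>
  have ab: "a * b \<le> 0"
  proof (rule ccontr)
    assume "\<not> a * b \<le> 0"
    then consider "1 \<le> a" "1 \<le> b" | "a < 0" "b < 0" by (fastforce simp: not_le zero_less_mult_iff)
    then show False
    proof cases
      case 1
      then have "1 * q' \<le> b * q'" "0 \<le> a * q" using q by (auto intro: mult_right_mono)
      then show False using n assms(3) by (simp add: q'_def)
    next
      case 2
      then have "a * q < 0" "b * q' < 0" using q by (auto simp: mult_less_0_iff)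
      then show False using n assms(2) by simp
    qed
  qed
  have "real_of_int n * \<theta> - real_of_int m =
      real_of_int a * conv_error \<theta> j + real_of_int b * conv_error \<theta> (Suc j)"
    unfolding n m by (simp add: conv_error_def p_def q_def p'_def q'_def algebra_simps)
  also have "\<bar>\<dots>\<bar> = \<bar>real_of_int a\<bar> * \<bar>conv_error \<theta> j\<bar> + \<bar>real_of_int b\<bar> * \<bar>conv_error \<theta> (Suc j)\<bar>"
    using ab by (intro abs_add_of_nonpos_mult conv_error_alternates[OF assms(1)])
      (metis of_int_0 of_int_le_iff of_int_mult)
  finally have "\<bar>real_of_int a\<bar> * \<bar>conv_error \<theta> j\<bar> \<le> \<bar>real_of_int n * \<theta> - real_of_int m\<bar>" by simp
  moreover have "1 * \<bar>conv_error \<theta> j\<bar> \<le> \<bar>real_of_int a\<bar> * \<bar>conv_error \<theta> j\<bar>"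
    using a0 by (intro mult_right_mono) linarith+
  ultimately show ?thesis by simp
qed

section \<open>Distance to the nearest integer and convergents of Liouville numbers\<close>

lemma dist_int_le: "dist_int x \<le> \<bar>x - real_of_int m\<bar>"
  unfolding dist_int_def using round_diff_minimal[of x m] by simp

lemma dist_int_pos:
  assumes "\<theta> \<notin> \<rat>" and "n > 0"
  shows "0 < dist_int (real n * \<theta>)"
proof -
  have "real n * \<theta> \<noteq> real_of_int k" for k
  proof
    assume "real n * \<theta> = real_of_int k"
    then have "\<theta> = real_of_int k / real n" using assms(2) by (simp add: field_simps)
    then show False using assms(1) by simp
  qed
  then show ?thesis by (simp add: dist_int_def)
qed

lemma dist_int_minus: "dist_int (- x) = dist_int x"
proof (rule antisym)
  show "dist_int (- x) \<le> dist_int x"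
    using dist_int_le[of "- x" "- round x"] by (simp add: dist_int_def)
  show "dist_int x \<le> dist_int (- x)"
    using dist_int_le[of x "- round (- x)"] by (simp add: dist_int_def)
qed

text \<open>A good approximation at n passes to the convergent with q_j <= n < q_(j+1). Taking n
  large pushes j past any given N, so growing exponents can be met along strictly increasing
  indices.\<close>

lemma liouville_convergents:
  assumes "\<theta> \<in> liouville_numbers"
  obtains s where "strict_mono s"
    and "\<And>i. \<bar>conv_error \<theta> (s i)\<bar> < real_of_int (conv_denom \<theta> (s i)) powr (- real i)"
proof -
  have irr: "\<theta> \<notin> \<rat>" using assms by (simp add: liouville_numbers_def)
  have ex: "\<exists>j\<ge>N. \<bar>conv_error \<theta> j\<bar> < real_of_int (conv_denom \<theta> j) powr (- real i)" for N i
  proof -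
    \<comment> \<open>The shift by 2 makes the exponent exceed 1 even for i = 0.\<close>
    have "infinite {n::nat. n > 0 \<and> dist_int (real n * \<theta>) < real n powr (- real (i + 2))}"
    proof -
      have "1 < real (i + 2)" by simp
      then show ?thesis using assms unfolding liouville_numbers_def by blast
    qed
    then obtain n where n: "nat (conv_denom \<theta> N) \<le> n" "n > 0"
        "dist_int (real n * \<theta>) < real n powr (- real (i + 2))"
      unfolding finite_nat_set_iff_bounded by (force simp: not_less)
    have "\<exists>k. int n < conv_denom \<theta> k"
      using conv_denom_ge_index[OF irr, of "Suc n"] by (intro exI[of _ "Suc n"]) simp
    then obtain k where k: "int n < conv_denom \<theta> k" "\<And>l. l < k \<Longrightarrow> \<not> int n < conv_denom \<theta> l"
      using LeastI_ex[of "\<lambda>k. int n < conv_denom \<theta> k"]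
        not_less_Least[of _ "\<lambda>k. int n < conv_denom \<theta> k"] by blast
    \<comment> \<open>The denominator at index 0 is 1, which is at most n, so the first denominator
      above n has a predecessor.\<close>
    have "k \<noteq> 0" using k(1) n(2) by (cases k) auto
    then obtain j where j: "k = Suc j" using not0_implies_Suc by blast
    have qj: "conv_denom \<theta> j \<le> int n" using k(2)[of j] j by simp
    have "N \<le> j"
    proof (rule ccontr)
      assume "\<not> N \<le> j"
      then have "conv_denom \<theta> k \<le> conv_denom \<theta> N"
        using j by (intro monoD[OF conv_denom_mono[OF irr]]) simp
      then show False using k(1) n(1) by linarith
    qed
    moreover have "\<bar>conv_error \<theta> j\<bar> < real_of_int (conv_denom \<theta> j) powr (- real i)"
    proof -
      have "\<bar>conv_error \<theta> j\<bar> \<le> dist_int (real n * \<theta>)"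
        using best_approximation[OF irr, of "int n" j "round (real n * \<theta>)"] n(2) k(1) j
        by (simp add: dist_int_def)
      also have "\<dots> < real n powr (- real (i + 2))" by (rule n(3))
      also have "\<dots> \<le> real n powr (- real i)" using n(2) by (intro powr_mono) auto
      also have "\<dots> \<le> real_of_int (conv_denom \<theta> j) powr (- real i)"
        using qj conv_denom_pos[OF irr, of j] by (intro powr_mono2') auto
      finally show ?thesis .
    qed
    ultimately show ?thesis by blast
  qed
  \<comment> \<open>Dependent choice: each stage asks for an index beyond the previous one and for
    an exponent larger by one.\<close>
  have "\<exists>s. \<forall>i. \<bar>conv_error \<theta> (s i)\<bar> < real_of_int (conv_denom \<theta> (s i)) powr (- real i)
      \<and> s i < s (Suc i)"
    using ex[of 0 0] ex[of "Suc _" "Suc _"]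
    by (intro dependent_nat_choice) (auto simp: Suc_le_eq simp del: of_nat_Suc)
  then show ?thesis using that by (auto simp: strict_mono_Suc_iff)
qed

section \<open>Growth classes in terms of representatives\<close>

text \<open>If k alone had U-full measure, U would be principal at k. So U contains the complement
  of every point and hence every tail, and ordinary limits of sequences remain limits along
  U.\<close>

lemma nonprincipal_ultrafilter_le_sequentially:
  assumes "nonprincipal_ultrafilter U"
  shows "U \<le> sequentially"
proof -
  have bot: "\<not> eventually (\<lambda>_. False) U"
    and ultra: "eventually P U \<or> eventually (\<lambda>i. \<not> P i) U" for P
    using assms by (auto simp: nonprincipal_ultrafilter_def)
  have ne: "\<forall>\<^sub>F i in U. i \<noteq> k" for k
  proof (rule ccontr)
    assume "\<not> ?thesis"
    with ultra have k: "\<forall>\<^sub>F i in U. i = k" by fastforce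
    have "eventually P U \<longleftrightarrow> eventually P (principal {k})" for P
    proof
      assume "eventually P U"
      with k have "\<forall>\<^sub>F i in U. P k" by eventually_elim simp
      with bot show "eventually P (principal {k})" by (cases "P k") (auto simp: eventually_principal)
    next
      assume "eventually P (principal {k})"
      with k show "eventually P U" by (auto simp: eventually_principal elim: eventually_mono)
    qed
    then have "U = principal {k}" by (simp add: filter_eq_iff)
    with assms show False by (simp add: nonprincipal_ultrafilter_def)
  qed
  have ge: "\<forall>\<^sub>F i in U. k \<le> i" for k :: nat
  proof (induction k)
    case (Suc k)
    with ne[of k] show ?case by eventually_elim simp
  qed simp
  show ?thesis
    by (rule filter_leI) (auto simp: eventually_sequentially intro: eventually_mono[OF ge])
qed

lemma nonprincipal_ultrafilter_eventuallyD:
  assumes "nonprincipal_ultrafilter U" and "\<forall>\<^sub>F i in U. P i"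
  obtains i where "P i"
  using assms unfolding nonprincipal_ultrafilter_def by (meson eventually_happens trivial_limit_def)

lemma gclass_abs: "gclass U (star U (\<lambda>i. \<bar>x i\<bar>)) = gclass U (star U x)"
  by (simp add: gclass_def hlift1_star)

lemma mem_gclass_iff:
  assumes U: "nonprincipal_ultrafilter U" and x: "\<forall>\<^sub>F i in U. 0 < x i"
  shows "Y \<in> gclass U (star U x) \<longleftrightarrow>
    (\<exists>y c d. Y = star U y \<and> 0 < c \<and> (\<forall>\<^sub>F i in U. c * x i < y i \<and> y i < d * x i))"
proof -
  have "habs U (star U x) = star U x"
    unfolding hlift1_star star_eq_iff using x by eventually_elim simp
  then have "Y \<in> gclass U (star U x) \<longleftrightarrow> (star U x, Y) \<in> growth_rel U"
    by (simp add: gclass_def)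
  moreover have "\<exists>y. Y = star U y" if "(star U x, Y) \<in> growth_rel U"
    using that by (auto simp: growth_rel_def hpos_def hyperreals_eq_range hconst_def)
  ultimately show ?thesis using growth_rel_star[OF U x] by blast
qed

text \<open>Rescaled representatives are the test elements that extract arbitrary constants from the
  order on classes.\<close>

lemma scaled_mem_gclass:
  assumes U: "nonprincipal_ultrafilter U" and x: "\<forall>\<^sub>F i in U. 0 < x i" and c: "0 < c"
  shows "star U (\<lambda>i. c * x i) \<in> gclass U (star U x)"
proof -
  have "\<forall>\<^sub>F i in U. c / 2 * x i < c * x i \<and> c * x i < 2 * c * x i"
    using x by eventually_elim (use c in auto)
  then show ?thesis unfolding mem_gclass_iff[OF U x] using c half_gt_zero by blast
qed

text \<open>The order quantifies over all representatives, and these vary by finite noninfinitesimal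
  factors. A strict inequality of classes therefore means that x / y is infinitesimal.\<close>

lemma gless_gclass_iff:
  assumes U: "nonprincipal_ultrafilter U"
    and x: "\<forall>\<^sub>F i in U. 0 < x i" and y: "\<forall>\<^sub>F i in U. 0 < y i"
  shows "gless U (gclass U (star U x)) (gclass U (star U y)) \<longleftrightarrow>
    (\<forall>c>0. \<forall>\<^sub>F i in U. x i < c * y i)"
proof (intro iffI allI impI)
  fix c :: real
  assume "gless U (gclass U (star U x)) (gclass U (star U y))" and c: "0 < c"
  then have "hless U (star U (\<lambda>i. 1 * x i)) (star U (\<lambda>i. c * y i))"
    using scaled_mem_gclass[OF U x zero_less_one] scaled_mem_gclass[OF U y c]
    unfolding gless_def by blast
  then show "\<forall>\<^sub>F i in U. x i < c * y i" by (simp add: hless_star)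
next
  assume *: "\<forall>c>0. \<forall>\<^sub>F i in U. x i < c * y i"
  have "hless U X Y" if XY: "X \<in> gclass U (star U x)" "Y \<in> gclass U (star U y)" for X Y
  proof -
    obtain x' a b where x': "X = star U x'" "\<forall>\<^sub>F i in U. a * x i < x' i \<and> x' i < b * x i"
      using XY(1) unfolding mem_gclass_iff[OF U x] by blast
    obtain y' c d where y': "Y = star U y'" "0 < c" "\<forall>\<^sub>F i in U. c * y i < y' i \<and> y' i < d * y i"
      using XY(2) unfolding mem_gclass_iff[OF U y] by blast
    \<comment> \<open>Replacing b by at least 1 makes the division below legitimate without deciding
      the sign of b.\<close>
    define B where "B = max b 1"
    have "0 < c / B" using y' by (simp add: B_def)
    with * have "\<forall>\<^sub>F i in U. x i < c / B * y i" by blast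
    with x'(2) y'(3) x have "\<forall>\<^sub>F i in U. x' i < y' i"
    proof eventually_elim
      case (elim i)
      have "b * x i \<le> B * x i" using elim by (intro mult_right_mono) (auto simp: B_def)
      moreover have "B * x i < c * y i" using elim by (simp add: B_def field_simps)
      ultimately show ?case using elim by linarith
    qed
    then show ?thesis by (simp add: x' y' hless_star)
  qed
  then show "gless U (gclass U (star U x)) (gclass U (star U y))" by (simp add: gless_def)
qed

text \<open>Strict inequality gives C = 1. Equality puts x into the class of y, which bounds it by a
  multiple of y.\<close>

lemma gle_gclassD:
  assumes U: "nonprincipal_ultrafilter U"
    and x: "\<forall>\<^sub>F i in U. 0 < x i" and y: "\<forall>\<^sub>F i in U. 0 < y i"
    and le: "gle U (gclass U (star U x)) (gclass U (star U y))"
  obtains C where "0 < C" and "\<forall>\<^sub>F i in U. x i < C * y i"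
proof (cases "gless U (gclass U (star U x)) (gclass U (star U y))")
  case True
  then show ?thesis using gless_gclass_iff[OF U x y] that zero_less_one by blast
next
  case False
  then have "star U (\<lambda>i. 1 * x i) \<in> gclass U (star U y)"
    using le scaled_mem_gclass[OF U x zero_less_one] by (simp add: gle_def)
  then obtain x' d where x': "star U x = star U x'" "\<forall>\<^sub>F i in U. x' i < d * y i"
    unfolding mem_gclass_iff[OF U y] eventually_conj_iff mult_1 by blast
  have "\<forall>\<^sub>F i in U. x i < max d 1 * y i"
    using x'(1)[unfolded star_eq_iff] x'(2) y
  proof eventually_elim
    case (elim i)
    have "d * y i \<le> max d 1 * y i" using elim by (intro mult_right_mono) auto
    then show ?case using elim by linarith
  qed
  then show ?thesis using that[of "max d 1"] by simp
qed

lemma gle_gless_trans: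
  assumes U: "nonprincipal_ultrafilter U"
    and x: "\<forall>\<^sub>F i in U. 0 < x i" and y: "\<forall>\<^sub>F i in U. 0 < y i" and z: "\<forall>\<^sub>F i in U. 0 < z i"
    and xy: "gle U (gclass U (star U x)) (gclass U (star U y))"
    and yz: "gless U (gclass U (star U y)) (gclass U (star U z))"
  shows "gless U (gclass U (star U x)) (gclass U (star U z))"
  unfolding gless_gclass_iff[OF U x z]
proof (intro allI impI)
  fix c :: real
  assume c: "0 < c"
  obtain C where C: "0 < C" "\<forall>\<^sub>F i in U. x i < C * y i" using gle_gclassD[OF U x y xy] .
  have "0 < c / C" using c C by simp
  then have "\<forall>\<^sub>F i in U. y i < c / C * z i" using yz gless_gclass_iff[OF U y z] by blast
  with C(2) show "\<forall>\<^sub>F i in U. x i < c * z i"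
  proof eventually_elim
    case (elim i)
    then have "C * y i < c * z i" using C(1) by (simp add: field_simps)
    then show ?case using elim by linarith
  qed
qed

text \<open>\<open>growth\<close> inverts a coset elementwise. Inversion carries the class of a
  positive sequence into the class of its reciprocal; applied once more to the reciprocal, this
  gives the reverse inclusion, since inversion is an involution.\<close>

lemma growth_star:
  assumes U: "nonprincipal_ultrafilter U" and n: "\<forall>\<^sub>F i in U. n i \<noteq> 0"
  shows "growth U (star U n) = gclass U (star U (\<lambda>i. 1 / \<bar>n i\<bar>))"
proof -
  have pos: "\<forall>\<^sub>F i in U. 0 < \<bar>n i\<bar>" and pos': "\<forall>\<^sub>F i in U. 0 < 1 / \<bar>n i\<bar>"
    using n by (eventually_elim, simp)+
  have inv: "hinverse U Y \<in> gclass U (star U (\<lambda>i. 1 / x i))"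
    if x: "\<forall>\<^sub>F i in U. 0 < x i" and Y: "Y \<in> gclass U (star U x)" for x Y
  proof -
    obtain y c d where y: "Y = star U y" "0 < c" and cd: "\<forall>\<^sub>F i in U. c * x i < y i \<and> y i < d * x i"
      using Y unfolding mem_gclass_iff[OF U x] by blast
    have x': "\<forall>\<^sub>F i in U. 0 < 1 / x i" using x by eventually_elim simp
    \<comment> \<open>The membership criterion leaves the sign of d open; a single index at which
      all bounds hold shows that it is positive.\<close>
    have d: "0 < d"
    proof (rule nonprincipal_ultrafilter_eventuallyD[OF U eventually_conj[OF cd x]])
      fix i
      assume i: "(c * x i < y i \<and> y i < d * x i) \<and> 0 < x i"
      then have "0 < c * x i" using y by simp
      then have "0 < d * x i" using i by linarith
      then show ?thesis using i by (simp add: zero_less_mult_iff)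
    qed
    have "\<forall>\<^sub>F i in U. 1 / d * (1 / x i) < inverse (y i) \<and> inverse (y i) < 1 / c * (1 / x i)"
      using cd x
    proof eventually_elim
      case (elim i)
      have "0 < c * x i" using y(2) elim by simp
      then have "inverse (d * x i) < inverse (y i)" "inverse (y i) < inverse (c * x i)"
        using elim by (intro less_imp_inverse_less; linarith)+
      then show ?case by (simp add: inverse_eq_divide)
    qed
    then show ?thesis
      unfolding y(1) hlift1_star mem_gclass_iff[OF U x'] using d
      by (intro exI[of _ "\<lambda>i. inverse (y i)"] exI[of _ "1 / d"] exI[of _ "1 / c"]) simp
  qed
  have "hinverse U ` gclass U (star U (\<lambda>i. \<bar>n i\<bar>)) = gclass U (star U (\<lambda>i. 1 / \<bar>n i\<bar>))"
  proof (intro equalityI subsetI)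
    fix Z
    assume Z: "Z \<in> gclass U (star U (\<lambda>i. 1 / \<bar>n i\<bar>))"
    then obtain z where z: "Z = star U z" unfolding mem_gclass_iff[OF U pos'] by blast
    have "hinverse U Z \<in> gclass U (star U (\<lambda>i. \<bar>n i\<bar>))" using inv[OF pos' Z] by simp
    moreover have "Z = hinverse U (hinverse U Z)" by (simp add: z hlift1_star)
    ultimately show "Z \<in> hinverse U ` gclass U (star U (\<lambda>i. \<bar>n i\<bar>))" by blast
  qed (use inv[OF pos] in auto)
  then show ?thesis by (simp add: growth_def ginverse_def gclass_abs)
qed

section \<open>Diophantine groups in terms of integer sequences\<close>

lemma infinitesimals_star:
  "star U x \<in> infinitesimals U \<longleftrightarrow> (\<forall>c>0. \<forall>\<^sub>F i in U. \<bar>x i\<bar> < c)"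
  by (simp add: infinitesimals_def hyperreals_eq_range hconst_def hlift1_star hless_star)

text \<open>The dual is unique, so any integer sequence m with infinitesimal errors represents it
  and computes the decay.\<close>

lemma dioph_star:
  fixes n m :: "nat \<Rightarrow> int"
  assumes small: "\<And>c. c > 0 \<Longrightarrow> \<forall>\<^sub>F i in U. \<bar>real_of_int (n i) * \<theta> - real_of_int (m i)\<bar> < c"
  shows "star U (\<lambda>i. real_of_int (n i)) \<in> dioph_group U \<theta>"
    and "decay U \<theta> (star U (\<lambda>i. real_of_int (n i))) =
           gclass U (star U (\<lambda>i. \<bar>real_of_int (n i) * \<theta> - real_of_int (m i)\<bar>))"
proof -
  let ?n = "star U (\<lambda>i. real_of_int (n i))" and ?m = "star U (\<lambda>i. real_of_int (m i))"
  have eps: "hdiff U (hmult U ?n (hconst U \<theta>)) ?m =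
      star U (\<lambda>i. real_of_int (n i) * \<theta> - real_of_int (m i))"
    by (simp add: hconst_def hlift2_star)
  have inf: "hdiff U (hmult U ?n (hconst U \<theta>)) ?m \<in> infinitesimals U"
    using small by (simp add: eps infinitesimals_star)
  have mem: "?n \<in> hyperints U" "?m \<in> hyperints U" by (auto simp: hyperints_def)
  show "?n \<in> dioph_group U \<theta>" using inf mem by (auto simp: dioph_group_def)
  have "dual U \<theta> ?n = ?m"
    unfolding dual_def
  proof (rule the_equality)
    fix m'
    assume "m' \<in> hyperints U \<and> hdiff U (hmult U ?n (hconst U \<theta>)) m' \<in> infinitesimals U"
    then show "m' = ?m"
      using mem inf by (intro dual_unique[of ?n U m' ?m \<theta>]) (auto simp: hyperreals_eq_range)
  qed (use mem inf in blast)
  then show "decay U \<theta> ?n = gclass U (star U (\<lambda>i. \<bar>real_of_int (n i) * \<theta> - real_of_int (m i)\<bar>))"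
    by (simp add: decay_def error_term_def eps gclass_abs)
qed

text \<open>Irrationality keeps the error of a nonzero integer away from 0; the criteria for
  comparing classes need this positivity.\<close>

lemma dioph_groupE:
  assumes U: "nonprincipal_ultrafilter U" and irr: "\<theta> \<notin> \<rat>"
    and N: "N \<in> dioph_group U \<theta>" "N \<noteq> hconst U 0"
  obtains n m :: "nat \<Rightarrow> int" where
    "N = star U (\<lambda>i. real_of_int (n i))" and "\<forall>\<^sub>F i in U. n i \<noteq> 0"
    and "\<And>c. c > 0 \<Longrightarrow> \<forall>\<^sub>F i in U. \<bar>real_of_int (n i) * \<theta> - real_of_int (m i)\<bar> < c"
    and "\<forall>\<^sub>F i in U. 0 < \<bar>real_of_int (n i) * \<theta> - real_of_int (m i)\<bar>"
proof -
  obtain n m where n: "N = star U (\<lambda>i. real_of_int (n i))"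
    and "hdiff U (hmult U N (hconst U \<theta>)) (star U (\<lambda>i. real_of_int (m i))) \<in> infinitesimals U"
    using N(1) by (auto simp: dioph_group_def hyperints_def)
  then have small: "\<forall>\<^sub>F i in U. \<bar>real_of_int (n i) * \<theta> - real_of_int (m i)\<bar> < c" if "c > 0" for c
    using that by (simp add: hconst_def hlift2_star infinitesimals_star)
  \<comment> \<open>A nonzero class is at first only not almost everywhere 0; the ultrafilter
    property upgrades this to nonzero almost everywhere.\<close>
  have "\<not> (\<forall>\<^sub>F i in U. n i = 0)"
    using N(2) by (simp add: n hconst_def star_eq_iff)
  then have nz: "\<forall>\<^sub>F i in U. n i \<noteq> 0"
    using U unfolding nonprincipal_ultrafilter_def by blast
  then have "\<forall>\<^sub>F i in U. 0 < \<bar>real_of_int (n i) * \<theta> - real_of_int (m i)\<bar>"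
  proof eventually_elim
    case (elim i)
    show ?case
    proof (rule ccontr)
      assume "\<not> ?thesis"
      then have "\<theta> = real_of_int (m i) / real_of_int (n i)" using elim by (simp add: field_simps)
      then show False using irr by simp
    qed
  qed
  with n nz small show ?thesis using that by blast
qed

text \<open>If some exponent had finitely many solutions, their distances to the integers would have
  a positive minimum. An infinitesimal error drops below it, producing a solution outside the
  list.\<close>

lemma liouvilleI:
  fixes n m :: "nat \<Rightarrow> int"
  assumes U: "nonprincipal_ultrafilter U" and irr: "\<theta> \<notin> \<rat>"
    and nz: "\<forall>\<^sub>F i in U. n i \<noteq> 0"
    and small: "\<And>c. c > 0 \<Longrightarrow> \<forall>\<^sub>F i in U. \<bar>real_of_int (n i) * \<theta> - real_of_int (m i)\<bar> < c"
    and approx: "\<And>\<kappa>. \<kappa> > 1 \<Longrightarrow> \<forall>\<^sub>F i in U.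
       \<bar>real_of_int (n i) * \<theta> - real_of_int (m i)\<bar> < \<bar>real_of_int (n i)\<bar> powr (- \<kappa>)"
  shows "\<theta> \<in> liouville_numbers"
proof -
  have "infinite {n::nat. n > 0 \<and> dist_int (real n * \<theta>) < real n powr (- \<kappa>)}" (is "infinite ?S")
    if \<kappa>: "\<kappa> > 1" for \<kappa>
  proof
    assume fin: "finite ?S"
    \<comment> \<open>The element 1 keeps the minimum defined when there are no solutions.\<close>
    define D where "D = insert 1 ((\<lambda>n. dist_int (real n * \<theta>)) ` ?S)"
    have D: "finite D" "D \<noteq> {}" using fin by (auto simp: D_def)
    have "0 < Min D" using D dist_int_pos[OF irr] by (auto simp: Min_gr_iff D_def)
    obtain i where i: "n i \<noteq> 0"
        "\<bar>real_of_int (n i) * \<theta> - real_of_int (m i)\<bar> < Min D"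
        "\<bar>real_of_int (n i) * \<theta> - real_of_int (m i)\<bar> < \<bar>real_of_int (n i)\<bar> powr (- \<kappa>)"
      using nonprincipal_ultrafilter_eventuallyD[OF U
          eventually_conj[OF nz eventually_conj[OF small[OF \<open>0 < Min D\<close>] approx[OF \<kappa>]]]]
      by blast
    \<comment> \<open>Liouville numbers are defined through natural n, so the sign of
      \<open>n i\<close> is dropped; the distance to the nearest integer is even.\<close>
    define k where "k = nat \<bar>n i\<bar>"
    have k: "k > 0" "real k = \<bar>real_of_int (n i)\<bar>" using i(1) by (auto simp: k_def)
    have "dist_int (real k * \<theta>) = dist_int (real_of_int (n i) * \<theta>)"
      using dist_int_minus[of "real_of_int (n i) * \<theta>"] by (simp add: k(2) abs_if)
    then have dist: "dist_int (real k * \<theta>) \<le> \<bar>real_of_int (n i) * \<theta> - real_of_int (m i)\<bar>"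
      using dist_int_le by metis
    then have "k \<in> ?S" using k i(3) by simp
    then have "dist_int (real k * \<theta>) \<in> D" by (auto simp: D_def)
    then have "Min D \<le> dist_int (real k * \<theta>)" using D by simp
    with dist i(2) show False by linarith
  qed
  then show ?thesis using irr by (auto simp: liouville_numbers_def)
qed

section \<open>Frobenius powers of representatives\<close>

lemma hconst_mem_pos_fin_units:
  assumes "nonprincipal_ultrafilter U" and "0 < l"
  shows "hconst U l \<in> pos_fin_units U"
  unfolding hconst_def pos_fin_units_star[OF assms(1)]
  using assms(2) by (intro exI[of _ "l / 2"] exI[of _ "2 * l"] conjI) simp_all

lemma frobenius_star:
  assumes U: "nonprincipal_ultrafilter U" and x: "\<forall>\<^sub>F i in U. 0 < x i"
    and r: "star U r \<in> pos_fin_units U"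
  shows "frobenius U (gclass U (star U x)) (star U r) = gclass U (star U (\<lambda>i. x i powr r i))"
  using frobenius_gclass[OF U _ r, of "star U x"] x by (simp add: hpos_star hlift2_star)

lemma frobenius_hconst:
  assumes U: "nonprincipal_ultrafilter U" and x: "\<forall>\<^sub>F i in U. 0 < x i" and "0 < l"
  shows "frobenius U (gclass U (star U x)) (hconst U l) = gclass U (star U (\<lambda>i. x i powr l))"
  using frobenius_star[OF U x] hconst_mem_pos_fin_units[OF U \<open>0 < l\<close>] by (simp add: hconst_def)

lemma growth_epsE:
  assumes "\<mu> \<in> growth_eps U"
  obtains x where "\<mu> = gclass U (star U x)" and "\<forall>\<^sub>F i in U. 0 < x i"
    and "\<And>c. c > 0 \<Longrightarrow> \<forall>\<^sub>F i in U. x i < c"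
proof -
  obtain x where x: "\<mu> = gclass U (star U x)" "star U x \<in> infinitesimals U" "star U x \<in> hpos U"
    using assms by (auto simp: growth_eps_def hpos_def hyperreals_eq_range)
  have "\<forall>\<^sub>F i in U. x i < c" if "c > 0" for c
  proof -
    have "\<forall>\<^sub>F i in U. \<bar>x i\<bar> < c" using x(2) that by (simp add: infinitesimals_star)
    then show ?thesis by eventually_elim simp
  qed
  then show ?thesis using that x by (simp add: hpos_star)
qed

section \<open>The equivalences\<close>

text \<open>The intersection supplies one N that serves every l at once; its growth condition is
  read off at l = 1.\<close>

lemma bigroup_Inter_nontrivialE:
  assumes "(\<Inter>l\<in>{1::real..}. dioph_bigroup U \<theta> \<mu> (frobenius U \<mu> (hconst U l))) \<noteq> {hconst U 0}"
  obtains N where "N \<in> dioph_group U \<theta>" "N \<noteq> hconst U 0" "gless U \<mu> (growth U N)"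
    "\<And>l. l \<ge> 1 \<Longrightarrow> gle U (decay U \<theta> N) (frobenius U \<mu> (hconst U l))"
proof -
  have "hconst U 0 \<in> (\<Inter>l\<in>{1::real..}. dioph_bigroup U \<theta> \<mu> (frobenius U \<mu> (hconst U l)))"
    by (simp add: dioph_bigroup_def)
  with assms obtain N where N: "N \<noteq> hconst U 0"
      "N \<in> (\<Inter>l\<in>{1::real..}. dioph_bigroup U \<theta> \<mu> (frobenius U \<mu> (hconst U l)))"
    by blast
  then have "N \<in> dioph_group U \<theta> \<and> gless U \<mu> (growth U N) \<and>
      gle U (decay U \<theta> N) (frobenius U \<mu> (hconst U l))" if "l \<ge> 1" for l
    using that by (auto simp: dioph_bigroup_def)
  then show ?thesis using that N(1) order_refl by blast
qed

text \<open>An inequality of classes bounds the error only up to a constant C, so it is used at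
  exponent \<kappa> + 1: for an infinitesimal representative x of \<mu>, the surplus factor x
  absorbs C. The growth condition gives x < 1 / |n|, which turns the remaining power of x into one
  of n.\<close>

lemma liouville_if_bigroup_Inter_nontrivial:
  assumes U: "nonprincipal_ultrafilter U" and irr: "\<theta> \<notin> \<rat>" and \<mu>: "\<mu> \<in> growth_eps U"
    and nontriv: "(\<Inter>l\<in>{1::real..}. dioph_bigroup U \<theta> \<mu> (frobenius U \<mu> (hconst U l))) \<noteq> {hconst U 0}"
  shows "\<theta> \<in> liouville_numbers"
proof -
  obtain N where N: "N \<in> dioph_group U \<theta>" "N \<noteq> hconst U 0" "gless U \<mu> (growth U N)"
    "\<And>l. l \<ge> 1 \<Longrightarrow> gle U (decay U \<theta> N) (frobenius U \<mu> (hconst U l))"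
    using bigroup_Inter_nontrivialE[OF nontriv] by blast
  obtain n m where n: "N = star U (\<lambda>i. real_of_int (n i))" and nz: "\<forall>\<^sub>F i in U. n i \<noteq> 0"
    and small: "\<And>c. c > 0 \<Longrightarrow> \<forall>\<^sub>F i in U. \<bar>real_of_int (n i) * \<theta> - real_of_int (m i)\<bar> < c"
    and pos: "\<forall>\<^sub>F i in U. 0 < \<bar>real_of_int (n i) * \<theta> - real_of_int (m i)\<bar>"
    using dioph_groupE[OF U irr N(1,2)] by blast
  obtain x where x: "\<mu> = gclass U (star U x)" "\<forall>\<^sub>F i in U. 0 < x i"
      "\<And>c. c > 0 \<Longrightarrow> \<forall>\<^sub>F i in U. x i < c"
    using growth_epsE[OF \<mu>] by blast
  have growth: "growth U N = gclass U (star U (\<lambda>i. 1 / \<bar>real_of_int (n i)\<bar>))"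
    unfolding n using nz by (intro growth_star[OF U]) simp
  have ipos: "\<forall>\<^sub>F i in U. 0 < 1 / \<bar>real_of_int (n i)\<bar>" using nz by eventually_elim simp
  have decay: "decay U \<theta> N = gclass U (star U (\<lambda>i. \<bar>real_of_int (n i) * \<theta> - real_of_int (m i)\<bar>))"
    unfolding n by (rule dioph_star(2)[OF small])
  have "\<forall>\<^sub>F i in U. x i < 1 * (1 / \<bar>real_of_int (n i)\<bar>)"
    using N(3) zero_less_one unfolding growth x(1) gless_gclass_iff[OF U x(2) ipos] by blast
  then have xn: "\<forall>\<^sub>F i in U. x i < 1 / \<bar>real_of_int (n i)\<bar>" by simp
  show ?thesis
  proof (rule liouvilleI[OF U irr nz small])
    fix \<kappa> :: real
    assume \<kappa>: "\<kappa> > 1"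
    have xl: "\<forall>\<^sub>F i in U. 0 < x i powr (\<kappa> + 1)" using x(2) by eventually_elim simp
    have "gle U (decay U \<theta> N) (gclass U (star U (\<lambda>i. x i powr (\<kappa> + 1))))"
      using N(4)[of "\<kappa> + 1"] \<kappa> frobenius_hconst[OF U x(2), of "\<kappa> + 1"] by (simp add: x(1))
    then obtain C where C: "0 < C"
        "\<forall>\<^sub>F i in U. \<bar>real_of_int (n i) * \<theta> - real_of_int (m i)\<bar> < C * x i powr (\<kappa> + 1)"
      unfolding decay using gle_gclassD[OF U pos xl] by blast
    have "\<forall>\<^sub>F i in U. x i < 1 / C" using C(1) by (intro x(3)) simp
    with C(2) xn nz x(2)
    show "\<forall>\<^sub>F i in U. \<bar>real_of_int (n i) * \<theta> - real_of_int (m i)\<bar> < \<bar>real_of_int (n i)\<bar> powr (- \<kappa>)"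
    proof eventually_elim
      case (elim i)
      have "C * x i powr (\<kappa> + 1) = (C * x i) * x i powr \<kappa>" using elim by (simp add: powr_add)
      also have "\<dots> \<le> 1 * x i powr \<kappa>"
        using elim C(1) by (intro mult_right_mono) (auto simp: field_simps)
      also have "\<dots> \<le> (1 / \<bar>real_of_int (n i)\<bar>) powr \<kappa>"
        using elim \<kappa> by (simp add: powr_mono2)
      also have "\<dots> = \<bar>real_of_int (n i)\<bar> powr (- \<kappa>)" by (simp add: powr_divide powr_minus_divide)
      finally show ?case using elim by linarith
    qed
  qed
qed

text \<open>The same N works on the whole interval: \<nu> <= \<mu> lies below its growth, and its
  decay is at most the power of \<mu> that bounds \<nu> from below.\<close>

lemma bigroup_nontrivial_on_interval:
  assumes U: "nonprincipal_ultrafilter U" and irr: "\<theta> \<notin> \<rat>" and \<mu>: "\<mu> \<in> growth_eps U"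
    and nontriv: "(\<Inter>l\<in>{1::real..}. dioph_bigroup U \<theta> \<mu> (frobenius U \<mu> (hconst U l))) \<noteq> {hconst U 0}"
    and \<nu>: "\<nu> \<in> frobenius_interval U \<mu>"
  shows "dioph_bigroup U \<theta> \<nu> \<nu> \<noteq> {hconst U 0}"
proof -
  obtain N where N: "N \<in> dioph_group U \<theta>" "N \<noteq> hconst U 0" "gless U \<mu> (growth U N)"
    "\<And>l. l \<ge> 1 \<Longrightarrow> gle U (decay U \<theta> N) (frobenius U \<mu> (hconst U l))"
    using bigroup_Inter_nontrivialE[OF nontriv] by blast
  obtain n m where n: "N = star U (\<lambda>i. real_of_int (n i))" and nz: "\<forall>\<^sub>F i in U. n i \<noteq> 0"
    and small: "\<And>c. c > 0 \<Longrightarrow> \<forall>\<^sub>F i in U. \<bar>real_of_int (n i) * \<theta> - real_of_int (m i)\<bar> < c"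
    and pos: "\<forall>\<^sub>F i in U. 0 < \<bar>real_of_int (n i) * \<theta> - real_of_int (m i)\<bar>"
    using dioph_groupE[OF U irr N(1,2)] by blast
  obtain x where x: "\<mu> = gclass U (star U x)" "\<forall>\<^sub>F i in U. 0 < x i"
    using growth_epsE[OF \<mu>] by blast
  obtain \<kappa> where \<kappa>: "\<kappa> > 1" "\<nu> \<in> growth_eps U" "gless U (frobenius U \<mu> (hconst U \<kappa>)) \<nu>" "gle U \<nu> \<mu>"
    using \<nu> by (auto simp: frobenius_interval_def)
  obtain y where y: "\<nu> = gclass U (star U y)" "\<forall>\<^sub>F i in U. 0 < y i"
    using growth_epsE[OF \<kappa>(2)] by blast
  have growth: "growth U N = gclass U (star U (\<lambda>i. 1 / \<bar>real_of_int (n i)\<bar>))"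
    unfolding n using nz by (intro growth_star[OF U]) simp
  have ipos: "\<forall>\<^sub>F i in U. 0 < 1 / \<bar>real_of_int (n i)\<bar>" using nz by eventually_elim simp
  have decay: "decay U \<theta> N = gclass U (star U (\<lambda>i. \<bar>real_of_int (n i) * \<theta> - real_of_int (m i)\<bar>))"
    unfolding n by (rule dioph_star(2)[OF small])
  have xl: "\<forall>\<^sub>F i in U. 0 < x i powr \<kappa>" using x(2) by eventually_elim simp
  have frob: "frobenius U \<mu> (hconst U \<kappa>) = gclass U (star U (\<lambda>i. x i powr \<kappa>))"
    using frobenius_hconst[OF U x(2), of \<kappa>] \<kappa>(1) by (simp add: x(1))
  have "gless U \<nu> (growth U N)"
    using N(3) \<kappa>(4) gle_gless_trans[OF U y(2) x(2) ipos] by (simp add: x(1) y(1) growth)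
  moreover have "gless U (decay U \<theta> N) \<nu>"
    using N(4)[of \<kappa>] \<kappa>(1,3) gle_gless_trans[OF U pos xl y(2)] by (simp add: y(1) frob decay)
  ultimately have "N \<in> dioph_bigroup U \<theta> \<nu> \<nu>"
    using N(1,2) by (simp add: dioph_bigroup_def gle_def)
  with N(2) show ?thesis by blast
qed

section \<open>Best denominator classes\<close>

lemma conv_denom_filterlim:
  assumes U: "nonprincipal_ultrafilter U" and irr: "\<theta> \<notin> \<rat>" and s: "filterlim s at_top sequentially"
  shows "filterlim (\<lambda>i. real_of_int (conv_denom \<theta> (s i))) at_top U"
proof -
  have "filterlim (\<lambda>k. real k) at_top sequentially" by (rule filterlim_real_sequentially)
  then have "filterlim (\<lambda>k. real_of_int (conv_denom \<theta> k)) at_top sequentially"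
  proof (rule filterlim_at_top_mono)
    have "real k \<le> real_of_int (conv_denom \<theta> k)" for k
      using conv_denom_ge_index[OF irr, of k] by linarith
    then show "\<forall>\<^sub>F k in sequentially. real k \<le> real_of_int (conv_denom \<theta> k)" by simp
  qed
  then have "filterlim (\<lambda>i. real_of_int (conv_denom \<theta> (s i))) at_top sequentially"
    using s by (rule filterlim_compose)
  then show ?thesis
    by (rule filterlim_mono[OF _ order_refl nonprincipal_ultrafilter_le_sequentially[OF U]])
qed

text \<open>The error at index k is at most the reciprocal of the next denominator, hence of the
  denominator at k, and the denominators tend to infinity along U.\<close>

lemma conv_error_small:
  assumes U: "nonprincipal_ultrafilter U" and irr: "\<theta> \<notin> \<rat>" and s: "filterlim s at_top sequentially"
    and c: "c > 0"
  shows "\<forall>\<^sub>F i in U. \<bar>conv_error \<theta> (s i)\<bar> < c"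
proof -
  have "\<forall>\<^sub>F i in U. 1 / c < real_of_int (conv_denom \<theta> (s i))"
    using conv_denom_filterlim[OF U irr s] unfolding filterlim_at_top_dense by blast
  then show ?thesis
  proof eventually_elim
    case (elim i)
    have q: "1 \<le> real_of_int (conv_denom \<theta> (s i))" using conv_denom_pos[OF irr, of "s i"] by simp
    have "real_of_int (conv_denom \<theta> (s i)) \<le> real_of_int (conv_denom \<theta> (Suc (s i)))"
      using monoD[OF conv_denom_mono[OF irr], of "s i" "Suc (s i)"] by simp
    then have "1 / real_of_int (conv_denom \<theta> (Suc (s i))) \<le> 1 / real_of_int (conv_denom \<theta> (s i))"
      using q by (intro divide_left_mono) auto
    also have "\<dots> < c" using elim c q by (simp add: field_simps)
    finally show ?case using conv_error_bound[OF irr, of "s i"] by linarith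
  qed
qed

text \<open>The convergent numerators represent the dual, so growth and decay become explicit
  sequences.\<close>

lemma best_denom_class_facts:
  assumes U: "nonprincipal_ultrafilter U" and irr: "\<theta> \<notin> \<rat>" and s: "filterlim s at_top sequentially"
  defines "Q \<equiv> star U (\<lambda>i. real_of_int (conv_denom \<theta> (s i)))"
  shows "Q \<in> dioph_group U \<theta>" and "Q \<noteq> hconst U 0"
    and "growth U Q = gclass U (star U (\<lambda>i. 1 / real_of_int (conv_denom \<theta> (s i))))"
    and "decay U \<theta> Q = gclass U (star U (\<lambda>i. \<bar>conv_error \<theta> (s i)\<bar>))"
proof -
  have pos: "0 < conv_denom \<theta> k" for k using conv_denom_pos[OF irr, of k] by simp
  have small: "\<forall>\<^sub>F i in U. \<bar>real_of_int (conv_denom \<theta> (s i)) * \<theta> - real_of_int (conv_num \<theta> (s i))\<bar> < c"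
    if "c > 0" for c
    using conv_error_small[OF U irr s that] by (simp add: conv_error_def)
  show "Q \<in> dioph_group U \<theta>" unfolding Q_def by (rule dioph_star(1)[OF small])
  show "decay U \<theta> Q = gclass U (star U (\<lambda>i. \<bar>conv_error \<theta> (s i)\<bar>))"
    unfolding Q_def conv_error_def by (rule dioph_star(2)[OF small])
  have "conv_denom \<theta> k \<noteq> 0" for k using pos[of k] by simp
  moreover from this have "Q \<noteq> hconst U 0 \<longleftrightarrow> U \<noteq> bot"
    by (simp add: Q_def hconst_def star_eq_iff trivial_limit_def)
  ultimately show "Q \<noteq> hconst U 0" using U by (simp add: nonprincipal_ultrafilter_def)
  show "growth U Q = gclass U (star U (\<lambda>i. 1 / real_of_int (conv_denom \<theta> (s i))))"
    unfolding Q_def using growth_star[OF U, of "\<lambda>i. real_of_int (conv_denom \<theta> (s i))"] pos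
    by (simp add: less_imp_le \<open>\<And>k. conv_denom \<theta> k \<noteq> 0\<close>)
qed

text \<open>Two orbit elements suffice for each \<kappa>: the decay to the power 1 and the growth to
  the power \<kappa>. Their comparison, with test constant 1, is the Liouville inequality at
  \<open>conv_denom \<theta> (s i)\<close>.\<close>

lemma liouville_if_orbit_less:
  assumes U: "nonprincipal_ultrafilter U" and irr: "\<theta> \<notin> \<rat>" and Q: "Q \<in> best_denom_classes U \<theta>"
    and less: "orbit_less U (frobenius_orbit U (decay U \<theta> Q)) (frobenius_orbit U (growth U Q))"
  shows "\<theta> \<in> liouville_numbers"
proof -
  obtain s where s: "Q = star U (\<lambda>i. real_of_int (conv_denom \<theta> (s i)))" "filterlim s at_top sequentially"
    using Q by (auto simp: best_denom_classes_def)
  note facts = best_denom_class_facts[OF U irr s(2), folded s(1)]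
  have q: "1 \<le> conv_denom \<theta> k" for k by (rule conv_denom_pos[OF irr])
  have q0: "0 < conv_denom \<theta> k" for k using q[of k] by simp
  have qpos: "\<forall>\<^sub>F i in U. 0 < 1 / real_of_int (conv_denom \<theta> (s i))"
    by (simp add: q0)
  have epos: "\<forall>\<^sub>F i in U. 0 < \<bar>conv_error \<theta> (s i)\<bar>" using conv_error_nonzero[OF irr] by simp
  show ?thesis
  proof (rule liouvilleI[OF U irr])
    show "\<forall>\<^sub>F i in U. conv_denom \<theta> (s i) \<noteq> 0" using q0 by (simp add: less_imp_neq[symmetric])
    show "\<forall>\<^sub>F i in U. \<bar>real_of_int (conv_denom \<theta> (s i)) * \<theta> - real_of_int (conv_num \<theta> (s i))\<bar> < c"
      if "c > 0" for c
      using conv_error_small[OF U irr s(2) that] by (simp add: conv_error_def)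
    fix \<kappa> :: real
    assume \<kappa>: "\<kappa> > 1"
    have pos: "\<forall>\<^sub>F i in U. 0 < \<bar>conv_error \<theta> (s i)\<bar> powr 1"
      "\<forall>\<^sub>F i in U. 0 < (1 / real_of_int (conv_denom \<theta> (s i))) powr \<kappa>"
      using epos qpos by (eventually_elim, simp)+
    have "gless U (frobenius U (decay U \<theta> Q) (hconst U 1)) (frobenius U (growth U Q) (hconst U \<kappa>))"
      using less hconst_mem_pos_fin_units[OF U, of 1] hconst_mem_pos_fin_units[OF U, of \<kappa>] \<kappa>
      by (auto simp: orbit_less_def frobenius_orbit_def)
    then have "gless U (gclass U (star U (\<lambda>i. \<bar>conv_error \<theta> (s i)\<bar> powr 1)))
        (gclass U (star U (\<lambda>i. (1 / real_of_int (conv_denom \<theta> (s i))) powr \<kappa>)))"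
      using frobenius_hconst[OF U epos, of 1] frobenius_hconst[OF U qpos, of \<kappa>] \<kappa> facts(3,4) by simp
    then have "\<forall>\<^sub>F i in U. \<bar>conv_error \<theta> (s i)\<bar> powr 1 <
        1 * (1 / real_of_int (conv_denom \<theta> (s i))) powr \<kappa>"
      unfolding gless_gclass_iff[OF U pos] using zero_less_one by blast
    then show "\<forall>\<^sub>F i in U. \<bar>real_of_int (conv_denom \<theta> (s i)) * \<theta> - real_of_int (conv_num \<theta> (s i))\<bar>
        < \<bar>real_of_int (conv_denom \<theta> (s i))\<bar> powr (- \<kappa>)"
    proof eventually_elim
      case (elim i)
      then show ?case
        using q0[of "s i"] by (simp add: conv_error_def powr_divide powr_minus_divide)
    qed
  qed
qed

text \<open>The three parameters fit both constructions below: a and b are the exponents put on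
  decay and growth, and c is the test constant in the strict order of classes.\<close>

lemma liouville_best_denom_class:
  assumes U: "nonprincipal_ultrafilter U" and \<theta>: "\<theta> \<in> liouville_numbers"
  obtains s where "star U (\<lambda>i. real_of_int (conv_denom \<theta> (s i))) \<in> best_denom_classes U \<theta>"
    and "filterlim s at_top sequentially"
    and "\<And>a b c. 0 < a \<Longrightarrow> 0 < c \<Longrightarrow> \<forall>\<^sub>F i in U.
       \<bar>conv_error \<theta> (s i)\<bar> powr a < c * (1 / real_of_int (conv_denom \<theta> (s i))) powr b"
proof -
  have irr: "\<theta> \<notin> \<rat>" using \<theta> by (simp add: liouville_numbers_def)
  obtain s where s: "strict_mono s"
    and err: "\<And>i. \<bar>conv_error \<theta> (s i)\<bar> < real_of_int (conv_denom \<theta> (s i)) powr (- real i)"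
    using liouville_convergents[OF \<theta>] by blast
  have lim: "filterlim s at_top sequentially" using s by (rule filterlim_subseq)
  have "star U (\<lambda>i. real_of_int (conv_denom \<theta> (s i))) \<in> best_denom_classes U \<theta>"
    using lim s unfolding best_denom_classes_def strict_mono_Suc_iff by (blast intro: less_imp_le)
  moreover have "\<forall>\<^sub>F i in U.
       \<bar>conv_error \<theta> (s i)\<bar> powr a < c * (1 / real_of_int (conv_denom \<theta> (s i))) powr b"
    if a: "0 < a" and c: "0 < c" for a b c
  proof -
    \<comment> \<open>From this index on, the exponent i * a reached by the error exceeds b by at
      least 1; the spare factor 1 / q then beats c.\<close>
    have "\<forall>\<^sub>F i in U. nat \<lceil>(b + 1) / a\<rceil> \<le> i"
      using nonprincipal_ultrafilter_le_sequentially[OF U] eventually_ge_at_top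
      by (rule filter_leD)
    moreover have "\<forall>\<^sub>F i in U. 1 / c < real_of_int (conv_denom \<theta> (s i))"
      using conv_denom_filterlim[OF U irr lim] unfolding filterlim_at_top_dense by blast
    ultimately show ?thesis
    proof eventually_elim
      case (elim i)
      define q where "q = real_of_int (conv_denom \<theta> (s i))"
      have q: "1 \<le> q" using conv_denom_pos[OF irr, of "s i"] by (simp add: q_def)
      have "(b + 1) / a \<le> real i" using elim(1) by linarith
      then have bi: "b + 1 \<le> real i * a" using a by (simp add: field_simps)
      have "\<bar>conv_error \<theta> (s i)\<bar> powr a \<le> (q powr (- real i)) powr a"
        using err[of i] a by (intro powr_mono2) (auto simp: q_def)
      also have "\<dots> = q powr (- (real i * a))" by (simp add: powr_powr)
      also have "\<dots> \<le> q powr (- b - 1)" using bi q by (intro powr_mono) auto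
      also have "\<dots> = (1 / q) * (1 / q) powr b"
        using q by (simp add: powr_diff powr_minus_divide powr_divide)
      also have "\<dots> < c * (1 / q) powr b"
        using elim(2) q c by (intro mult_strict_right_mono) (auto simp: q_def field_simps)
      finally show ?case by (simp add: q_def)
    qed
  qed
  ultimately show ?thesis using that lim by blast
qed

text \<open>Orbit elements carry nonstandard exponents, but r has a positive standard lower bound a
  and t a standard upper bound b. Both bases are eventually at most 1, so a smaller exponent gives a
  larger power, and the claim reduces to the standard exponents a and b.\<close>

lemma orbit_less_if_liouville:
  assumes U: "nonprincipal_ultrafilter U" and \<theta>: "\<theta> \<in> liouville_numbers"
  shows "\<exists>Q \<in> best_denom_classes U \<theta>.
     orbit_less U (frobenius_orbit U (decay U \<theta> Q)) (frobenius_orbit U (growth U Q))"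
proof -
  have irr: "\<theta> \<notin> \<rat>" using \<theta> by (simp add: liouville_numbers_def)
  obtain s where best: "star U (\<lambda>i. real_of_int (conv_denom \<theta> (s i))) \<in> best_denom_classes U \<theta>"
      (is "?Q \<in> _") and lim: "filterlim s at_top sequentially"
    and approx: "\<And>a b c. 0 < a \<Longrightarrow> 0 < c \<Longrightarrow> \<forall>\<^sub>F i in U.
       \<bar>conv_error \<theta> (s i)\<bar> powr a < c * (1 / real_of_int (conv_denom \<theta> (s i))) powr b"
    using liouville_best_denom_class[OF U \<theta>] by blast
  have q0: "0 < conv_denom \<theta> k" for k using conv_denom_pos[OF irr, of k] by simp
  have qpos: "\<forall>\<^sub>F i in U. 0 < 1 / real_of_int (conv_denom \<theta> (s i))" by (simp add: q0)
  have epos: "\<forall>\<^sub>F i in U. 0 < \<bar>conv_error \<theta> (s i)\<bar>" using conv_error_nonzero[OF irr] by simp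
  have "gless U (frobenius U (decay U \<theta> ?Q) R) (frobenius U (growth U ?Q) T)"
    if R: "R \<in> pos_fin_units U" and T: "T \<in> pos_fin_units U" for R T
  proof -
    obtain r t where rt: "R = star U r" "T = star U t"
      using R T by (auto simp: pos_fin_units_def hpos_def hyperreals_eq_range)
    obtain a where a: "0 < a" "\<forall>\<^sub>F i in U. a < r i"
      using R unfolding rt pos_fin_units_star[OF U] eventually_conj_iff by blast
    obtain b where b: "\<forall>\<^sub>F i in U. t i < b"
      using T unfolding rt pos_fin_units_star[OF U] eventually_conj_iff by blast
    have eq: "frobenius U (decay U \<theta> ?Q) R = gclass U (star U (\<lambda>i. \<bar>conv_error \<theta> (s i)\<bar> powr r i))"
      "frobenius U (growth U ?Q) T =
        gclass U (star U (\<lambda>i. (1 / real_of_int (conv_denom \<theta> (s i))) powr t i))"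
      unfolding best_denom_class_facts[OF U irr lim] rt
      using R T frobenius_star[OF U epos] frobenius_star[OF U qpos] by (simp_all add: rt)
    have pos: "\<forall>\<^sub>F i in U. 0 < \<bar>conv_error \<theta> (s i)\<bar> powr r i"
      "\<forall>\<^sub>F i in U. 0 < (1 / real_of_int (conv_denom \<theta> (s i))) powr t i"
      using epos qpos by (eventually_elim, simp)+
    show ?thesis
      unfolding eq gless_gclass_iff[OF U pos]
    proof (intro allI impI)
      fix c :: real
      assume c: "0 < c"
      show "\<forall>\<^sub>F i in U. \<bar>conv_error \<theta> (s i)\<bar> powr r i
          < c * (1 / real_of_int (conv_denom \<theta> (s i))) powr t i"
        using approx[OF a(1) c, of b] a(2) b conv_error_small[OF U irr lim zero_less_one]
      proof eventually_elim
        case (elim i)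
        have q: "1 \<le> real_of_int (conv_denom \<theta> (s i))" using conv_denom_pos[OF irr, of "s i"] by simp
        have "\<bar>conv_error \<theta> (s i)\<bar> powr r i \<le> \<bar>conv_error \<theta> (s i)\<bar> powr a"
          using elim by (intro powr_mono') auto
        moreover have "c * (1 / real_of_int (conv_denom \<theta> (s i))) powr b
            \<le> c * (1 / real_of_int (conv_denom \<theta> (s i))) powr t i"
          using elim q c by (intro mult_left_mono powr_mono') auto
        ultimately show ?case using elim by linarith
      qed
    qed
  qed
  then show ?thesis using best by (auto simp: orbit_less_def frobenius_orbit_def)
qed

lemma bigroup_Inter_nontrivial_if_liouville:
  assumes U: "nonprincipal_ultrafilter U" and \<theta>: "\<theta> \<in> liouville_numbers"
  shows "\<exists>\<mu> \<in> growth_eps U.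
     (\<Inter>l\<in>{1::real..}. dioph_bigroup U \<theta> \<mu> (frobenius U \<mu> (hconst U l))) \<noteq> {hconst U 0}"
proof -
  have irr: "\<theta> \<notin> \<rat>" using \<theta> by (simp add: liouville_numbers_def)
  obtain s where "star U (\<lambda>i. real_of_int (conv_denom \<theta> (s i))) \<in> best_denom_classes U \<theta>"
    and lim: "filterlim s at_top sequentially"
    and approx: "\<And>a b c. 0 < a \<Longrightarrow> 0 < c \<Longrightarrow> \<forall>\<^sub>F i in U.
       \<bar>conv_error \<theta> (s i)\<bar> powr a < c * (1 / real_of_int (conv_denom \<theta> (s i))) powr b"
    using liouville_best_denom_class[OF U \<theta>] by blast
  define Q where "Q = star U (\<lambda>i. real_of_int (conv_denom \<theta> (s i)))"
  note facts = best_denom_class_facts[OF U irr lim, folded Q_def]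
  define w where "w = (\<lambda>i. 1 / real_of_int (conv_denom \<theta> (s i)))"
  have q0: "0 < conv_denom \<theta> k" for k using conv_denom_pos[OF irr, of k] by simp
  have wpos: "0 < w i" "w i \<le> 1" for i
    using conv_denom_pos[OF irr, of "s i"] by (simp_all add: w_def)
  have wsmall: "\<forall>\<^sub>F i in U. w i < c" if c: "c > 0" for c
  proof -
    have "\<forall>\<^sub>F i in U. 1 / c < real_of_int (conv_denom \<theta> (s i))"
      using conv_denom_filterlim[OF U irr lim] unfolding filterlim_at_top_dense by blast
    then show ?thesis
      by eventually_elim (use c q0 in \<open>simp add: w_def field_simps\<close>)
  qed
  \<comment> \<open>The square makes \<mu> strictly smaller than the growth of Q, as the bigroup
    requires; w itself would give equality.\<close>
  define \<mu> where "\<mu> = gclass U (star U (\<lambda>i. w i powr 2))"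
  have wpos': "\<forall>\<^sub>F i in U. 0 < w i" using wpos by simp
  then have w2pos: "\<forall>\<^sub>F i in U. 0 < w i powr 2" by eventually_elim simp
  have w2: "w i powr 2 = w i * w i" for i using wpos[of i] by (simp add: power2_eq_square)
  have w2le: "w i powr 2 \<le> w i" for i
    unfolding w2 using wpos[of i] by (simp add: mult_left_le)
  have "star U (\<lambda>i. w i powr 2) \<in> infinitesimals U"
    unfolding infinitesimals_star
  proof (intro allI impI)
    fix c :: real
    assume "0 < c"
    from wsmall[OF this] show "\<forall>\<^sub>F i in U. \<bar>w i powr 2\<bar> < c"
    proof eventually_elim
      case (elim i)
      then show ?case using w2le[of i] by simp
    qed
  qed
  then have \<mu>: "\<mu> \<in> growth_eps U" using w2pos by (auto simp: \<mu>_def growth_eps_def hpos_star)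
  have growth: "gless U \<mu> (growth U Q)"
    unfolding \<mu>_def facts(3) w_def[symmetric] gless_gclass_iff[OF U w2pos wpos']
  proof (intro allI impI)
    fix c :: real
    assume "0 < c"
    from wsmall[OF this] show "\<forall>\<^sub>F i in U. w i powr 2 < c * w i"
      by eventually_elim (use wpos in \<open>simp add: w2\<close>)
  qed
  have decay: "gle U (decay U \<theta> Q) (frobenius U \<mu> (hconst U l))" if l: "l \<ge> 1" for l
  proof -
    have epos: "\<forall>\<^sub>F i in U. 0 < \<bar>conv_error \<theta> (s i)\<bar>" using conv_error_nonzero[OF irr] by simp
    have wl: "\<forall>\<^sub>F i in U. 0 < (w i powr 2) powr l" using w2pos by eventually_elim simp
    have frob: "frobenius U \<mu> (hconst U l) = gclass U (star U (\<lambda>i. (w i powr 2) powr l))"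
      unfolding \<mu>_def using l by (intro frobenius_hconst[OF U w2pos]) simp
    have "gless U (decay U \<theta> Q) (frobenius U \<mu> (hconst U l))"
      unfolding facts(4) frob gless_gclass_iff[OF U epos wl]
    proof (intro allI impI)
      fix c :: real
      assume c: "0 < c"
      \<comment> \<open>The power l of \<mu> is the power 2 * l of w, which the error beats with any
        constant.\<close>
      show "\<forall>\<^sub>F i in U. \<bar>conv_error \<theta> (s i)\<bar> < c * (w i powr 2) powr l"
        using approx[OF zero_less_one c, of "2 * l"] unfolding powr_powr by (simp add: w_def)
    qed
    then show ?thesis by (simp add: gle_def)
  qed
  have "Q \<in> (\<Inter>l\<in>{1::real..}. dioph_bigroup U \<theta> \<mu> (frobenius U \<mu> (hconst U l)))"
    using facts(1,2) growth decay by (simp add: dioph_bigroup_def)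
  with facts(2) \<mu> show ?thesis by blast
qed

theorem corollary1:
  fixes U :: "nat filter" and \<theta> :: real
  assumes "nonprincipal_ultrafilter U" and "\<theta> \<notin> \<rat>"
  shows
    "(\<theta> \<in> liouville_numbers \<longleftrightarrow>
        (\<exists>\<mu> \<in> growth_eps U.
           (\<Inter>l\<in>{1::real..}. dioph_bigroup U \<theta> \<mu> (frobenius U \<mu> (hconst U l))) \<noteq> {hconst U 0}))
     \<and> (\<theta> \<in> liouville_numbers \<longleftrightarrow>
        (\<exists>q \<in> best_denom_classes U \<theta>.
           orbit_less U (frobenius_orbit U (decay U \<theta> q)) (frobenius_orbit U (growth U q))))
     \<and> (\<forall>\<mu> \<in> growth_eps U.
          (\<Inter>l\<in>{1::real..}. dioph_bigroup U \<theta> \<mu> (frobenius U \<mu> (hconst U l))) \<noteq> {hconst U 0}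
          \<longrightarrow> (\<forall>\<nu> \<in> frobenius_interval U \<mu>. dioph_bigroup U \<theta> \<nu> \<nu> \<noteq> {hconst U 0}))"
  using liouville_if_bigroup_Inter_nontrivial[OF assms]
    bigroup_Inter_nontrivial_if_liouville[OF assms(1)]
    liouville_if_orbit_less[OF assms] orbit_less_if_liouville[OF assms(1)]
    bigroup_nontrivial_on_interval[OF assms]
  by (intro conjI iffI ballI impI) (assumption | elim bexE | rule)+

end
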